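(* Let $\hat{\mathfrak g}$ be the untwisted affine Lie algebra of a simple finite-dimensional complex Lie algebra $\mathfrak g$, with standard Borel subalgebra $\hat{\mathfrak b}$. Then: (a) For every basic ideal $\mathfrak i$ of $\hat{\mathfrak b}$ we have $\mathrm{supp}(\mathfrak i)\supset D':=\bigcup_{k>0}D_k$. (b) Every equivalence class of combinatorial ideals of $\hat{\mathfrak b}$ contains a unique basic ideal. (c) The number of equivalence classes of combinatorial ideals of $\hat{\mathfrak b}$ is finite.
   Context: **Affine algebra.** Let $\mathfrak g=\mathfrak n_-\oplus\mathfrak h\oplus\mathfrak n_+$ be a triangular decomposition, $\Delta=\Delta_+\cup\Delta_-$ the root system of $\mathfrak g$. The untwisted affine Lie algebra $\hat{\mathfrak g}=\mathfrak g\otimes\mathbb C[t,t^{-1}]\oplus\mathbb Cc\oplus\mathbb Cd$ is obtained from the loop algebra (bracket $[x\otimes t^k,y\otimes t^l]=[x,y]\otimes t^{k+l}$) by the universal central extension (center $\mathbb Cc$) and by adjoining the derivation $d$, $[d,x\otimes t^k]=k\,x\otimes t^k$. Put $\hat{\mathfrak h}=\mathfrak h\oplus\mathbb Cc\oplus\mathbb Cd$; $\hat{\mathfrak n}_+$ is spanned by $\mathfrak n_+\otimes 1$ and all $x\otimes t^k$ with $x\in\mathfrak g$, $k>0$; $\hat{\mathfrak b}=\hat{\mathfrak h}\oplus\hat{\mathfrak n}_+$. $\hat{\mathfrak g}_\alpha$ is the root space of a root $\alpha$; $\delta$ is the indivisible positive imaginary root (so $\hat{\mathfrak g}_{\delta}=\mathfrak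 h\otimes t$); $\Delta$ is viewed as a set of roots of $\hat{\mathfrak g}$ via $x\mapsto x\otimes1$. **The sets $D_k$.** $D=D_0=\Delta_+\cup\{\delta\}\cup\{\alpha+\delta:\alpha\in\Delta_-\}$ and $D_k=D+k\delta$ for $k>0$; the set $\hat\Delta_+$ of positive roots (roots of $\hat{\mathfrak n}_+$) is the disjoint union of all $D_k$, $k\ge0$. **Ideals.** An ideal $\mathfrak i$ of $\hat{\mathfrak b}$ is *strong* if it has finite codimension in $\hat{\mathfrak b}$ and $\mathfrak i\subset\hat{\mathfrak n}_+$; *thick* if for every root $\alpha$, $\mathfrak i\cap\hat{\mathfrak g}_\alpha\ne0$ implies $\hat{\mathfrak g}_\alpha\subset\mathfrak i$; *combinatorial* if strong and thick. For combinatorial $\mathfrak i$, $\mathrm{supp}(\mathfrak i)$ is the set of roots $\alpha$ with $\hat{\mathfrak g}_\alpha\subset\mathfrak i$. Combinatorial ideals $\mathfrak i,\mathfrak j$ are *equivalent* if $\mathrm{supp}(\mathfrak i)=k\delta+\mathrm{supp}(\mathfrak j)$ for some $k\in\mathbb Z$. A combinatorial ideal $\mathfrak i$ is *basic* if $\mathrm{supp}(\mathfrak i)\cap D\ne\varnothing$. *)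

theory Defs
  imports Complex_Main "HOL-Library.Poly_Mapping" "HOL-Library.Product_Plus"
begin

locale lie_algebra = vector_space scale
  for scale :: "complex \<Rightarrow> 'a::ab_group_add \<Rightarrow> 'a" (infixr \<open>*s\<close> 75) +
  fixes br :: "'a \<Rightarrow> 'a \<Rightarrow> 'a"
  assumes br_add_left: "br (x + y) z = br x z + br y z"
    and br_add_right: "br x (y + z) = br x y + br x z"
    and br_scale_left: "br (c *s x) y = c *s br x y"
    and br_scale_right: "br x (c *s y) = c *s br x y"
    and br_self: "br x x = 0"
    and jacobi: "br x (br y z) + br y (br z x) + br z (br x y) = 0"
begin

definition ideal_of :: "'a set \<Rightarrow> 'a set \<Rightarrow> bool" where
  "ideal_of B I \<longleftrightarrow> subspace I \<and> I \<subseteq> B \<and> (\<forall>x\<in>B. \<forall>y\<in>I. br x y \<in> I)"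

definition finite_codim :: "'a set \<Rightarrow> 'a set \<Rightarrow> bool" where
  "finite_codim B I \<longleftrightarrow> (\<exists>F. finite F \<and> F \<subseteq> B \<and> B \<subseteq> span (I \<union> F))"

definition finite_dim :: bool where
  "finite_dim \<longleftrightarrow> (\<exists>F. finite F \<and> span F = UNIV)"

definition simple :: bool where
  "simple \<longleftrightarrow> (\<exists>x y. br x y \<noteq> 0) \<and> (\<forall>I. ideal_of UNIV I \<longrightarrow> I = {0} \<or> I = UNIV)"

text \<open>Linear forms on a subspace \<open>H\<close>, represented by functions on the whole space that
  vanish outside \<open>H\<close>, so that equality of functions is equality of forms on \<open>H\<close>.\<close>

definition dual :: "'a set \<Rightarrow> ('a \<Rightarrow> complex) set" where
  "dual H = {\<alpha>. (\<forall>x\<in>H. \<forall>y\<in>H. \<alpha> (x + y) = \<alpha> x + \<alpha> y) \<and>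
                (\<forall>c. \<forall>x\<in>H. \<alpha> (c *s x) = c * \<alpha> x) \<and> (\<forall>x. x \<notin> H \<longrightarrow> \<alpha> x = 0)}"

definition root_space :: "'a set \<Rightarrow> ('a \<Rightarrow> complex) \<Rightarrow> 'a set" where
  "root_space H \<alpha> = {x. \<forall>h\<in>H. br h x = \<alpha> h *s x}"

definition roots :: "'a set \<Rightarrow> ('a \<Rightarrow> complex) set" where
  "roots H = {\<alpha> \<in> dual H. \<alpha> \<noteq> (\<lambda>_. 0) \<and> root_space H \<alpha> \<noteq> {0}}"

lemma br_zero_left [simp]: "br 0 y = 0"
  using br_add_left[of 0 0 y] by simp

lemma br_zero_right [simp]: "br x 0 = 0"
  using br_add_right[of x 0 0] by simp

lemma br_minus: "br x y = - br y x"
proof -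
  have "br (x + y) (x + y) = (br x x + br y x) + (br x y + br y y)"
    by (simp only: br_add_left br_add_right)
  then have "br x y + br y x = 0"
    unfolding br_self by (simp add: add.commute)
  then show ?thesis
    by (simp only: eq_neg_iff_add_eq_0)
qed

end

text \<open>A triangular decomposition with Cartan subalgebra \<open>H\<close> and positive roots \<open>Pos\<close>.
  The assumption \<open>tri_span\<close> says that \<open>H\<close> acts diagonalizably and is its own centralizer,
  so for simple finite-dimensional algebras \<open>H\<close> is exactly a Cartan subalgebra.\<close>

locale triangular_lie_algebra = lie_algebra scale br
  for scale :: "complex \<Rightarrow> 'a::ab_group_add \<Rightarrow> 'a" (infixr \<open>*s\<close> 75)
    and br :: "'a \<Rightarrow> 'a \<Rightarrow> 'a" +
  fixes H :: "'a set" and Pos :: "('a \<Rightarrow> complex) set"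
begin

definition Neg :: "('a \<Rightarrow> complex) set" where
  "Neg = (\<lambda>\<alpha> x. - \<alpha> x) ` Pos"

definition n_plus :: "'a set" where
  "n_plus = span (\<Union>\<alpha>\<in>Pos. root_space H \<alpha>)"

definition n_minus :: "'a set" where
  "n_minus = span (\<Union>\<alpha>\<in>Neg. root_space H \<alpha>)"

definition triangular_decomposition :: bool where
  "triangular_decomposition \<longleftrightarrow>
     subspace H \<and> (\<forall>x\<in>H. \<forall>y\<in>H. br x y = 0) \<and>
     roots H = Pos \<union> Neg \<and> Pos \<inter> Neg = {} \<and>
     (\<forall>\<alpha>\<in>Pos. \<forall>\<beta>\<in>Pos. (\<lambda>x. \<alpha> x + \<beta> x) \<in> roots H \<longrightarrow> (\<lambda>x. \<alpha> x + \<beta> x) \<in> Pos) \<and>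
     (\<forall>x. \<exists>a\<in>n_minus. \<exists>h\<in>H. \<exists>b\<in>n_plus. x = a + h + b) \<and>
     (\<forall>a\<in>n_minus. \<forall>h\<in>H. \<forall>b\<in>n_plus. a + h + b = 0 \<longrightarrow> a = 0 \<and> h = 0 \<and> b = 0)"

end

text \<open>The element \<open>(f, a, b)\<close> stands for \<open>(\<Sum>k. f k \<otimes> t^k) + a c + b d\<close>; in particular
  \<open>x \<otimes> t^k\<close> is \<open>(Poly_Mapping.single k x, 0, 0)\<close>.\<close>

type_synonym 'a affine = "(int \<Rightarrow>\<^sub>0 'a) \<times> complex \<times> complex"

text \<open>A simple Lie algebra with a triangular decomposition and the invariant form that enters the
  bracket of the affine algebra. Such a form is a nonzero multiple of the Killing form, so the
  cocycle below defines the universal central extension of the loop algebra whatever the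
  normalization; rescaling the form amounts to rescaling \<open>c\<close>.\<close>

locale affine_datum = triangular_lie_algebra scale br H Pos
  for scale :: "complex \<Rightarrow> 'a::ab_group_add \<Rightarrow> 'a" (infixr \<open>*s\<close> 75)
    and br :: "'a \<Rightarrow> 'a \<Rightarrow> 'a"
    and H :: "'a set" and Pos :: "('a \<Rightarrow> complex) set" +
  fixes form :: "'a \<Rightarrow> 'a \<Rightarrow> complex"
  assumes fin_dim: finite_dim
    and simple: simple
    and triangular: triangular_decomposition
    and form_add: "form (x + y) z = form x z + form y z"
    and form_scale: "form (c *s x) y = c * form x y"
    and form_sym: "form x y = form y x"
    and form_invariant: "form (br x y) z = form x (br y z)"
    and form_nondegenerate: "(\<forall>y. form x y = 0) \<Longrightarrow> x = 0"
begin

definition aff_scale :: "complex \<Rightarrow> 'a affine \<Rightarrow> 'a affine" where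
  "aff_scale c = (\<lambda>(f, a, b). (Poly_Mapping.map (scale c) f, c * a, c * b))"

definition loop_br :: "(int \<Rightarrow>\<^sub>0 'a) \<Rightarrow> (int \<Rightarrow>\<^sub>0 'a) \<Rightarrow> (int \<Rightarrow>\<^sub>0 'a)" where
  "loop_br f g = (\<Sum>k\<in>Poly_Mapping.keys f. \<Sum>l\<in>Poly_Mapping.keys g.
     Poly_Mapping.single (k + l) (br (Poly_Mapping.lookup f k) (Poly_Mapping.lookup g l)))"

definition cocycle :: "(int \<Rightarrow>\<^sub>0 'a) \<Rightarrow> (int \<Rightarrow>\<^sub>0 'a) \<Rightarrow> complex" where
  "cocycle f g = (\<Sum>k\<in>Poly_Mapping.keys f.
     of_int k * form (Poly_Mapping.lookup f k) (Poly_Mapping.lookup g (- k)))"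

definition degree_der :: "(int \<Rightarrow>\<^sub>0 'a) \<Rightarrow> (int \<Rightarrow>\<^sub>0 'a)" where
  "degree_der f = (\<Sum>k\<in>Poly_Mapping.keys f.
     Poly_Mapping.single k (of_int k *s Poly_Mapping.lookup f k))"

definition aff_br :: "'a affine \<Rightarrow> 'a affine \<Rightarrow> 'a affine" where
  "aff_br = (\<lambda>(f, a, b) (g, a', b').
     (loop_br f g + Poly_Mapping.map (scale b) (degree_der g)
                  - Poly_Mapping.map (scale b') (degree_der f), cocycle f g, 0))"

lemma form_zero_left [simp]: "form 0 y = 0"
  using form_add[of 0 0 y] by simp

lemma form_zero_right [simp]: "form y 0 = 0"
  using form_sym[of y 0] by simp

lemma form_add_right: "form x (y + z) = form x y + form x z"
  by (simp only: form_sym[of x] form_add)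

lemma form_scale_right: "form x (c *s y) = c * form x y"
  by (simp only: form_sym[of x] form_scale)

lemma lookup_map_scale:
  "Poly_Mapping.lookup (Poly_Mapping.map (scale c) f) k = c *s Poly_Mapping.lookup f k"
  by (simp add: Poly_Mapping.map.rep_eq when_def)

lemma lookup_degree_der:
  "Poly_Mapping.lookup (degree_der f) k = of_int k *s Poly_Mapping.lookup f k"
  unfolding degree_der_def
  by (auto simp: lookup_sum lookup_single when_def in_keys_iff)

lemma keys_add_subset: "Poly_Mapping.keys (f + g) \<subseteq> Poly_Mapping.keys f \<union> Poly_Mapping.keys g"
  by (auto simp: in_keys_iff lookup_add)

lemma keys_scale_subset: "Poly_Mapping.keys (Poly_Mapping.map (scale c) f) \<subseteq> Poly_Mapping.keys f"
  by (auto simp: in_keys_iff lookup_map_scale)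

lemma loop_br_over:
  assumes "finite K" "Poly_Mapping.keys f \<subseteq> K" "finite L" "Poly_Mapping.keys g \<subseteq> L"
  shows "loop_br f g = (\<Sum>k\<in>K. \<Sum>l\<in>L.
     Poly_Mapping.single (k + l) (br (Poly_Mapping.lookup f k) (Poly_Mapping.lookup g l)))"
proof -
  have 1: "(\<Sum>l\<in>Poly_Mapping.keys g. Poly_Mapping.single (k + l) (br x (Poly_Mapping.lookup g l)))
      = (\<Sum>l\<in>L. Poly_Mapping.single (k + l) (br x (Poly_Mapping.lookup g l)))" for k x
    using assms by (intro sum.mono_neutral_left) (auto simp: in_keys_iff)
  show ?thesis
    unfolding loop_br_def 1
    using assms by (intro sum.mono_neutral_left) (auto simp: in_keys_iff)
qed

lemma cocycle_over:
  assumes "finite K" "Poly_Mapping.keys f \<subseteq> K"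
  shows "cocycle f g = (\<Sum>k\<in>K.
     of_int k * form (Poly_Mapping.lookup f k) (Poly_Mapping.lookup g (- k)))"
  unfolding cocycle_def
  using assms by (intro sum.mono_neutral_left) (auto simp: in_keys_iff)

lemma loop_br_add_left: "loop_br (f + f') g = loop_br f g + loop_br f' g"
proof -
  let ?K = "Poly_Mapping.keys f \<union> Poly_Mapping.keys f'" and ?L = "Poly_Mapping.keys g"
  show ?thesis
    by (subst (1 2 3) loop_br_over[of ?K _ ?L])
       (auto dest: subsetD[OF keys_add_subset] simp: lookup_add br_add_left single_add sum.distrib)
qed

lemma loop_br_add_right: "loop_br f (g + g') = loop_br f g + loop_br f g'"
proof -
  let ?L = "Poly_Mapping.keys g \<union> Poly_Mapping.keys g'" and ?K = "Poly_Mapping.keys f"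
  show ?thesis
    by (subst (1 2 3) loop_br_over[of ?K _ ?L])
       (auto dest: subsetD[OF keys_add_subset] simp: lookup_add br_add_right single_add sum.distrib)
qed

lemma map_scale_add:
  "Poly_Mapping.map (scale c) (f + g) = Poly_Mapping.map (scale c) f + Poly_Mapping.map (scale c) g"
  by (rule poly_mapping_eqI) (simp add: lookup_map_scale lookup_add scale_right_distrib)

lemma map_scale_sum:
  "Poly_Mapping.map (scale c) (sum F A) = (\<Sum>x\<in>A. Poly_Mapping.map (scale c) (F x))"
  by (rule poly_mapping_eqI) (simp add: lookup_map_scale lookup_sum scale_sum_right)

lemma map_scale_single:
  "Poly_Mapping.map (scale c) (Poly_Mapping.single k x) = Poly_Mapping.single k (c *s x)"
  by (rule poly_mapping_eqI) (simp add: lookup_map_scale lookup_single when_def)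

lemma loop_br_scale_left:
  "loop_br (Poly_Mapping.map (scale c) f) g = Poly_Mapping.map (scale c) (loop_br f g)"
proof -
  let ?K = "Poly_Mapping.keys f" and ?L = "Poly_Mapping.keys g"
  show ?thesis
    by (subst (1 2) loop_br_over[of ?K _ ?L])
       (auto dest: subsetD[OF keys_scale_subset] simp: lookup_map_scale br_scale_left map_scale_sum map_scale_single)
qed

lemma loop_br_scale_right:
  "loop_br f (Poly_Mapping.map (scale c) g) = Poly_Mapping.map (scale c) (loop_br f g)"
proof -
  let ?K = "Poly_Mapping.keys f" and ?L = "Poly_Mapping.keys g"
  show ?thesis
    by (subst (1 2) loop_br_over[of ?K _ ?L])
       (auto dest: subsetD[OF keys_scale_subset] simp: lookup_map_scale br_scale_right map_scale_sum map_scale_single)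
qed

lemma cocycle_add_left: "cocycle (f + f') g = cocycle f g + cocycle f' g"
proof -
  let ?K = "Poly_Mapping.keys f \<union> Poly_Mapping.keys f'"
  show ?thesis
    by (subst (1 2 3) cocycle_over[of ?K])
       (auto dest: subsetD[OF keys_add_subset] simp: lookup_add form_add sum.distrib distrib_left)
qed

lemma cocycle_add_right: "cocycle f (g + g') = cocycle f g + cocycle f g'"
  unfolding cocycle_def by (simp add: lookup_add form_add_right sum.distrib distrib_left)

lemma cocycle_scale_left: "cocycle (Poly_Mapping.map (scale c) f) g = c * cocycle f g"
  by (subst (1 2) cocycle_over[of "Poly_Mapping.keys f"])
     (auto dest: subsetD[OF keys_scale_subset] simp: lookup_map_scale form_scale sum_distrib_left mult_ac)

lemma cocycle_scale_right: "cocycle f (Poly_Mapping.map (scale c) g) = c * cocycle f g"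
  unfolding cocycle_def
  by (simp add: lookup_map_scale form_scale_right sum_distrib_left mult_ac)

lemma loop_br_single:
  "loop_br (Poly_Mapping.single k x) (Poly_Mapping.single l y) = Poly_Mapping.single (k + l) (br x y)"
  by (subst loop_br_over[of "{k}" _ "{l}"]) auto

lemma cocycle_single:
  "cocycle (Poly_Mapping.single k x) (Poly_Mapping.single l y) =
     (if k + l = 0 then of_int k * form x y else 0)"
  by (subst cocycle_over[of "{k}"]) (auto simp: lookup_single when_def)

lemma degree_der_add: "degree_der (f + g) = degree_der f + degree_der g"
  by (rule poly_mapping_eqI) (simp add: lookup_degree_der lookup_add scale_right_distrib)

lemma degree_der_scale:
  "degree_der (Poly_Mapping.map (scale c) f) = Poly_Mapping.map (scale c) (degree_der f)"
  by (rule poly_mapping_eqI) (simp add: lookup_degree_der lookup_map_scale mult_ac)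

lemma degree_der_single:
  "degree_der (Poly_Mapping.single k x) = Poly_Mapping.single k (of_int k *s x)"
  by (rule poly_mapping_eqI) (simp add: lookup_degree_der lookup_single when_def)

lemma map_scale_add_scalar:
  "Poly_Mapping.map (scale (a + b)) f = Poly_Mapping.map (scale a) f + Poly_Mapping.map (scale b) f"
  by (rule poly_mapping_eqI) (simp add: lookup_map_scale lookup_add scale_left_distrib)

lemma map_scale_map_scale:
  "Poly_Mapping.map (scale a) (Poly_Mapping.map (scale b) f) = Poly_Mapping.map (scale (a * b)) f"
  by (rule poly_mapping_eqI) (simp add: lookup_map_scale)

lemma map_scale_diff:
  "Poly_Mapping.map (scale c) (f - g) = Poly_Mapping.map (scale c) f - Poly_Mapping.map (scale c) g"
  by (rule poly_mapping_eqI) (simp add: lookup_map_scale lookup_minus scale_right_diff_distrib)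

lemma aff_br_add_left: "aff_br (X + Y) Z = aff_br X Z + aff_br Y Z"
  by (cases X; cases Y; cases Z)
     (simp add: aff_br_def loop_br_add_left cocycle_add_left degree_der_add map_scale_add
        map_scale_add_scalar)

lemma aff_br_add_right: "aff_br X (Y + Z) = aff_br X Y + aff_br X Z"
  by (cases X; cases Y; cases Z)
     (simp add: aff_br_def loop_br_add_right cocycle_add_right degree_der_add map_scale_add
        map_scale_add_scalar)

lemma aff_induct [case_names add gen]:
  assumes add: "\<And>X Y. P X \<Longrightarrow> P Y \<Longrightarrow> P (X + Y)"
    and gen: "\<And>k x a b. P (Poly_Mapping.single k x, a, b)"
  shows "P (X :: 'a affine)"
proof -
  obtain f a b where X: "X = (f, a, b)" by (cases X)
  have "P (\<Sum>k\<in>K. Poly_Mapping.single k (Poly_Mapping.lookup f k), 0, 0)" if "finite K" for K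
    using that
  proof induction
    case empty
    show ?case using gen[of 0 0 0 0] by simp
  next
    case (insert k K)
    then show ?case using add[OF gen[of k "Poly_Mapping.lookup f k" 0 0] insert.IH] by simp
  qed
  from add[OF this[OF finite_keys[of f]] gen[of 0 0 a b]]
  have "P ((\<Sum>k\<in>Poly_Mapping.keys f. Poly_Mapping.single k (Poly_Mapping.lookup f k)), a, b)"
    by simp
  moreover have "(\<Sum>k\<in>Poly_Mapping.keys f. Poly_Mapping.single k (Poly_Mapping.lookup f k)) = f"
    by (rule poly_mapping_eqI)
       (auto simp: lookup_sum lookup_single when_def in_keys_iff)
  ultimately show ?thesis using X by simp
qed

lemma aff_br_gen:
  "aff_br (Poly_Mapping.single k x, a, b) (Poly_Mapping.single l y, a', b') =
   (Poly_Mapping.single (k + l) (br x y) + Poly_Mapping.single l ((b * of_int l) *s y)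
      - Poly_Mapping.single k ((b' * of_int k) *s x),
    if k + l = 0 then of_int k * form x y else 0, 0)"
  by (simp add: aff_br_def loop_br_single cocycle_single degree_der_single map_scale_single)

lemma aff_br_antisym: "aff_br X Y + aff_br Y X = 0"
proof (induction X rule: aff_induct)
  case (add X X')
  have "aff_br (X + X') Y + aff_br Y (X + X') =
      (aff_br X Y + aff_br Y X) + (aff_br X' Y + aff_br Y X')"
    unfolding aff_br_add_left aff_br_add_right by simp
  then show ?case using add by simp
next
  case (gen k x a b)
  show ?case
  proof (induction Y rule: aff_induct)
    case (add Y Y')
    let ?X = "(Poly_Mapping.single k x, a, b)"
    have "aff_br ?X (Y + Y') + aff_br (Y + Y') ?X =
        (aff_br ?X Y + aff_br Y ?X) + (aff_br ?X Y' + aff_br Y' ?X)"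
      unfolding aff_br_add_left aff_br_add_right by simp
    then show ?case using add by simp
  next
    case (gen l y a' b')
    have "Poly_Mapping.single (k + l) (br x y) + Poly_Mapping.single (l + k) (br y x) = 0"
      using br_minus[of x y] by (simp add: add.commute flip: single_add)
    moreover have "of_int k * form x y + of_int l * form x y = 0" if "k + l = 0"
      using that by (metis distrib_right mult_zero_left of_int_0 of_int_add)
    ultimately show ?case
      by (auto simp: aff_br_gen form_sym[of y x] zero_prod_def algebra_simps)
  qed
qed

lemma aff_br_self: "aff_br X X = 0"
proof -
  obtain f a b where X: "aff_br X X = (f, a, b)" by (cases "aff_br X X")
  have *: "f + f = 0" "a + a = 0" "b + b = 0"
    using aff_br_antisym[of X X] unfolding X by (auto simp: zero_prod_def)
  have "Poly_Mapping.lookup f k = 0" for k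
  proof -
    have "2 *s Poly_Mapping.lookup f k = Poly_Mapping.lookup (f + f) k"
      using scale_left_distrib[of 1 1] by (simp add: lookup_add)
    then show ?thesis using * by simp
  qed
  then have "f = 0" by (intro poly_mapping_eqI) simp
  then show ?thesis using * X by (simp add: zero_prod_def)
qed

lemma loop_br_diff_right: "loop_br f (g - h) = loop_br f g - loop_br f h"
  using loop_br_add_right[of f "g - h" h] by simp

lemma cocycle_diff_right: "cocycle f (g - h) = cocycle f g - cocycle f h"
  using cocycle_add_right[of f "g - h" h] by simp

lemma degree_der_diff: "degree_der (f - g) = degree_der f - degree_der g"
  by (rule poly_mapping_eqI) (simp add: lookup_degree_der lookup_minus scale_right_diff_distrib)

lemma aff_br_gen_nested:
  "aff_br (Poly_Mapping.single k x, a, b)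
     (aff_br (Poly_Mapping.single l y, a', b') (Poly_Mapping.single m z, a'', b'')) =
   (Poly_Mapping.single (k + l + m) (br x (br y z))
      + Poly_Mapping.single (k + m) ((b' * of_int m) *s br x z)
      - Poly_Mapping.single (k + l) ((b'' * of_int l) *s br x y)
      + Poly_Mapping.single (l + m) ((b * of_int (l + m)) *s br y z)
      + Poly_Mapping.single m ((b * b' * of_int m * of_int m) *s z)
      - Poly_Mapping.single l ((b * b'' * of_int l * of_int l) *s y),
    (if k + l + m = 0 then of_int k * form x (br y z) else 0)
      + (if k + m = 0 then of_int k * b' * of_int m * form x z else 0)
      - (if k + l = 0 then of_int k * b'' * of_int l * form x y else 0), 0)"
  unfolding aff_br_gen
  by (auto simp: aff_br_def loop_br_add_right loop_br_diff_right cocycle_add_right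
      cocycle_diff_right degree_der_add degree_der_diff loop_br_single cocycle_single
      degree_der_single map_scale_add map_scale_diff map_scale_single br_scale_right
      form_scale_right add.assoc mult_ac)

lemma aff_jacobi_gen:
  fixes k l m :: int and x y z :: 'a and a b a' b' a'' b'' :: complex
  defines "X \<equiv> (Poly_Mapping.single k x, a, b)"
    and "Y \<equiv> (Poly_Mapping.single l y, a', b')"
    and "Z \<equiv> (Poly_Mapping.single m z, a'', b'')"
  shows "aff_br X (aff_br Y Z) + aff_br Y (aff_br Z X) + aff_br Z (aff_br X Y) = 0"
proof -
  let ?s = Poly_Mapping.single
  have J: "?s (k + l + m) (br x (br y z)) + ?s (l + m + k) (br y (br z x))
      + ?s (m + k + l) (br z (br x y)) = 0"
    using jacobi[of x y z] by (simp add: add_ac flip: single_add)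
  have C: "(if k + l + m = 0 then of_int k * form x (br y z) else 0)
      + (if l + m + k = 0 then of_int l * form y (br z x) else 0)
      + (if m + k + l = 0 then of_int m * form z (br x y) else 0) = 0"
  proof -
    have "form y (br z x) = form x (br y z)" "form z (br x y) = form x (br y z)"
      using form_invariant[of y z x] form_invariant[of x y z]
      by (simp_all add: form_sym[of x "br y z"] form_sym[of z "br x y"])
    moreover have "of_int k * form x (br y z) + of_int l * form x (br y z)
        + of_int m * form x (br y z) = 0" if "k + l + m = 0"
      using that by (metis distrib_right mult_zero_left of_int_0 of_int_add)
    ultimately show ?thesis by (auto simp: add_ac)
  qed
  have A: "?s (l + k) (c *s br y x) = - ?s (k + l) (c *s br x y)"
    "?s (m + k) (c *s br z x) = - ?s (k + m) (c *s br x z)"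
    "?s (m + l) (c *s br z y) = - ?s (l + m) (c *s br y z)" for c
    by (simp_all only: br_minus[of y x] br_minus[of z x] br_minus[of z y]
        scale_minus_right single_uminus add.commute[of l k] add.commute[of m k] add.commute[of m l])
  have S: "?s n ((c * of_int (p + q)) *s v) = ?s n ((c * of_int p) *s v) + ?s n ((c * of_int q) *s v)"
    for n p q :: int and c v
    by (simp add: distrib_left scale_left_distrib single_add)
  have poly: "fst (aff_br X (aff_br Y Z) + aff_br Y (aff_br Z X) + aff_br Z (aff_br X Y)) = 0"
  proof -
    have "fst (aff_br X (aff_br Y Z) + aff_br Y (aff_br Z X) + aff_br Z (aff_br X Y)) =
      ?s (k + l + m) (br x (br y z)) + ?s (l + m + k) (br y (br z x))
      + ?s (m + k + l) (br z (br x y))"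
      unfolding X_def Y_def Z_def aff_br_gen_nested S A
      by (simp add: A mult_ac add.commute[of m k] add.commute[of m l] add.commute[of l k])
    then show ?thesis using J by simp
  qed
  have form_part: "fst (snd (aff_br X (aff_br Y Z) + aff_br Y (aff_br Z X) + aff_br Z (aff_br X Y))) = 0"
  proof -
    have F: "form y x = form x y" "form z x = form x z" "form z y = form y z"
      by (rule form_sym)+
    have "fst (snd (aff_br X (aff_br Y Z) + aff_br Y (aff_br Z X) + aff_br Z (aff_br X Y))) =
      (if k + l + m = 0 then of_int k * form x (br y z) else 0)
      + (if l + m + k = 0 then of_int l * form y (br z x) else 0)
      + (if m + k + l = 0 then of_int m * form z (br x y) else 0)"
      unfolding X_def Y_def Z_def aff_br_gen_nested
      by (simp add: F mult_ac add.commute[of m k] add.commute[of m l] add.commute[of l k])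
    then show ?thesis using C by simp
  qed
  have "snd (snd (aff_br X (aff_br Y Z) + aff_br Y (aff_br Z X) + aff_br Z (aff_br X Y))) = 0"
    unfolding X_def Y_def Z_def aff_br_gen_nested by simp
  with poly form_part show ?thesis by (simp add: prod_eq_iff)
qed

lemma aff_jacobi: "aff_br X (aff_br Y Z) + aff_br Y (aff_br Z X) + aff_br Z (aff_br X Y) = 0"
proof -
  define J where
    "J X Y Z = aff_br X (aff_br Y Z) + aff_br Y (aff_br Z X) + aff_br Z (aff_br X Y)" for X Y Z
  have J1: "J (X + X') Y Z = J X Y Z + J X' Y Z" for X X' Y Z
    unfolding J_def aff_br_add_left aff_br_add_right by (simp add: add_ac)
  have J2: "J X (Y + Y') Z = J X Y Z + J X Y' Z" for X Y Y' Z
    unfolding J_def aff_br_add_left aff_br_add_right by (simp add: add_ac)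
  have J3: "J X Y (Z + Z') = J X Y Z + J X Y Z'" for X Y Z Z'
    unfolding J_def aff_br_add_left aff_br_add_right by (simp add: add_ac)
  have gen: "J (Poly_Mapping.single k x, a, b) (Poly_Mapping.single l y, a', b')
      (Poly_Mapping.single m z, a'', b'') = 0" for k l m x y z a b a' b' a'' b''
    unfolding J_def by (rule aff_jacobi_gen)
  have 1: "J (Poly_Mapping.single k x, a, b) (Poly_Mapping.single l y, a', b') Z = 0"
    for k l x y a b a' b' Z
    by (induction Z rule: aff_induct) (simp_all add: J3 gen)
  have 2: "J (Poly_Mapping.single k x, a, b) Y Z = 0" for k x a b Y Z
    by (induction Y rule: aff_induct) (simp_all add: J2 1)
  have "J X Y Z = 0"
    by (induction X rule: aff_induct) (simp_all add: J1 2)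
  then show ?thesis by (simp add: J_def)
qed

sublocale aff: lie_algebra aff_scale aff_br
proof
  fix c e :: complex and X Y Z :: "'a affine"
  show "aff_scale c (X + Y) = aff_scale c X + aff_scale c Y"
    by (cases X; cases Y) (simp add: aff_scale_def map_scale_add distrib_left)
  show "aff_scale (c + e) X = aff_scale c X + aff_scale e X"
    by (cases X) (simp add: aff_scale_def map_scale_add_scalar distrib_right)
  show "aff_scale c (aff_scale e X) = aff_scale (c * e) X"
    by (cases X) (simp add: aff_scale_def map_scale_map_scale)
  show "aff_scale 1 X = X"
    by (cases X) (auto simp: aff_scale_def lookup_map_scale intro!: poly_mapping_eqI)
  show "aff_br (X + Y) Z = aff_br X Z + aff_br Y Z" by (rule aff_br_add_left)
  show "aff_br X (Y + Z) = aff_br X Y + aff_br X Z" by (rule aff_br_add_right)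
  show "aff_br (aff_scale c X) Y = aff_scale c (aff_br X Y)"
    by (cases X; cases Y)
       (simp add: aff_br_def aff_scale_def loop_br_scale_left cocycle_scale_left degree_der_scale
          map_scale_add map_scale_diff map_scale_map_scale mult_ac)
  show "aff_br X (aff_scale c Y) = aff_scale c (aff_br X Y)"
    by (cases X; cases Y)
       (simp add: aff_br_def aff_scale_def loop_br_scale_right cocycle_scale_right degree_der_scale
          map_scale_add map_scale_diff map_scale_map_scale mult_ac)
  show "aff_br X X = 0" by (rule aff_br_self)
  show "aff_br X (aff_br Y Z) + aff_br Y (aff_br Z X) + aff_br Z (aff_br X Y) = 0"
    by (rule aff_jacobi)
qed

definition aff_H :: "'a affine set" where
  "aff_H = {(Poly_Mapping.single 0 h, a, b) |h a b. h \<in> H}"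

definition aff_n_plus :: "'a affine set" where
  "aff_n_plus = aff.span ({(Poly_Mapping.single 0 x, 0, 0) |x. x \<in> n_plus} \<union>
                          {(Poly_Mapping.single k x, 0, 0) |k x. k > 0})"

definition aff_borel :: "'a affine set" where
  "aff_borel = {h + n |h n. h \<in> aff_H \<and> n \<in> aff_n_plus}"

text \<open>Forms on \<open>H\<close> are viewed as forms on \<open>aff_H\<close> that vanish on \<open>c\<close> and \<open>d\<close>; the imaginary
  root \<open>delta\<close> is the form that vanishes on \<open>H\<close> and \<open>c\<close> and takes the value 1 on \<open>d\<close>.\<close>

definition ext :: "('a \<Rightarrow> complex) \<Rightarrow> ('a affine \<Rightarrow> complex)" where
  "ext \<alpha> = (\<lambda>X. if X \<in> aff_H then \<alpha> (Poly_Mapping.lookup (fst X) 0) else 0)"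

definition delta :: "'a affine \<Rightarrow> complex" where
  "delta = (\<lambda>X. if X \<in> aff_H then snd (snd X) else 0)"

definition shift :: "int \<Rightarrow> ('a affine \<Rightarrow> complex) \<Rightarrow> ('a affine \<Rightarrow> complex)" where
  "shift k \<beta> = (\<lambda>X. \<beta> X + of_int k * delta X)"

definition D :: "nat \<Rightarrow> ('a affine \<Rightarrow> complex) set" where
  "D k = shift (int k) ` (ext ` Pos \<union> {delta} \<union> {shift 1 (ext \<alpha>) |\<alpha>. \<alpha> \<in> Neg})"

abbreviation aff_roots :: "('a affine \<Rightarrow> complex) set" where
  "aff_roots \<equiv> aff.roots aff_H"

abbreviation aff_root_space :: "('a affine \<Rightarrow> complex) \<Rightarrow> 'a affine set" where
  "aff_root_space \<equiv> aff.root_space aff_H"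

definition strong_ideal :: "'a affine set \<Rightarrow> bool" where
  "strong_ideal I \<longleftrightarrow>
     aff.ideal_of aff_borel I \<and> aff.finite_codim aff_borel I \<and> I \<subseteq> aff_n_plus"

definition thick_ideal :: "'a affine set \<Rightarrow> bool" where
  "thick_ideal I \<longleftrightarrow> aff.ideal_of aff_borel I \<and>
     (\<forall>\<alpha>\<in>aff_roots. I \<inter> aff_root_space \<alpha> \<noteq> {0} \<longrightarrow> aff_root_space \<alpha> \<subseteq> I)"

definition combinatorial_ideals :: "'a affine set set" where
  "combinatorial_ideals = {I. strong_ideal I \<and> thick_ideal I}"

definition supp :: "'a affine set \<Rightarrow> ('a affine \<Rightarrow> complex) set" where
  "supp I = {\<alpha> \<in> aff_roots. aff_root_space \<alpha> \<subseteq> I}"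

definition equivalent_ideals :: "('a affine set \<times> 'a affine set) set" where
  "equivalent_ideals = {(I, J). I \<in> combinatorial_ideals \<and> J \<in> combinatorial_ideals \<and>
                                (\<exists>k. supp I = shift k ` supp J)}"

definition basic_ideal :: "'a affine set \<Rightarrow> bool" where
  "basic_ideal I \<longleftrightarrow> I \<in> combinatorial_ideals \<and> supp I \<inter> D 0 \<noteq> {}"

lemma shift_0 [simp]: "shift 0 \<beta> = \<beta>"
  by (simp add: shift_def)

lemma shift_shift [simp]: "shift k (shift l \<beta>) = shift (k + l) \<beta>"
  by (simp add: shift_def algebra_simps)

lemma equiv_equivalent_ideals: "equiv combinatorial_ideals equivalent_ideals"
proof (rule equivI)
  show "equivalent_ideals \<subseteq> combinatorial_ideals \<times> combinatorial_ideals"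
    by (auto simp: equivalent_ideals_def)
  show "refl_on combinatorial_ideals equivalent_ideals"
    by (auto simp: refl_on_def equivalent_ideals_def intro!: exI[of _ 0])
  show "sym equivalent_ideals"
  proof (rule symI)
    fix I J assume "(I, J) \<in> equivalent_ideals"
    then obtain k where k: "I \<in> combinatorial_ideals" "J \<in> combinatorial_ideals"
      "supp I = shift k ` supp J"
      by (auto simp: equivalent_ideals_def)
    then have "supp J = shift (- k) ` supp I" by (simp add: image_image)
    with k show "(J, I) \<in> equivalent_ideals" by (auto simp: equivalent_ideals_def)
  qed
  show "trans equivalent_ideals"
    by (rule transI) (auto simp: equivalent_ideals_def image_image)
qed

end

end

theory Submission
  imports Defs
begin

text \<open>A root \<open>\<gamma> + n \<delta>\<close> has level \<open>n\<close> if \<open>\<gamma>\<close> is a positive root and \<open>n - 1\<close> otherwise, so \<open>D\<^sub>k\<close> is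
  the set of roots of level \<open>k\<close>. If a thick ideal contains a root vector of level \<open>0\<close>, the bracket
  with an opposite root vector (nonzero by nondegeneracy of the form) puts \<open>\<delta>\<close> into the support, and
  brackets with \<open>h \<otimes> t\<close> then produce every root of level at least \<open>1\<close>. Multiplication by
  \<open>t\<^sup>-\<^sup>m\<close>, where \<open>m\<close> is the least level in the support, turns a combinatorial ideal into an
  equivalent basic one; no other translate can be basic. A combinatorial ideal is spanned by its
  root spaces, so a basic ideal is determined by the part of its support in the finite set \<open>D\<close>.\<close>

subsection \<open>Weight vectors\<close>

text \<open>Roots are handled as pairs (\<gamma>, n) with the zero weight included, so that
  translating \<gamma> + n \<delta> is integer addition. Two obstacles shape the proof. First, H
  \<otimes> C[t] is abelian, so brackets with h \<otimes> t yield real roots only; the multiples k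
  \<delta> with k \<ge> 2 are recovered from a real root \<beta> + \<delta> by a second bracket with
  an opposite root vector. Second, multiplication by t^k is not an automorphism of the affine
  algebra: it makes sense on the loop part only. It respects the action of the Borel subalgebra, up
  to a multiple of the identity coming from d, as long as both the ideal and its translate lie in
  \<open>aff_n_plus\<close>, where the cocycle against \<open>aff_borel\<close> vanishes.
  Translating by the least level is the choice that keeps the translate in \<open>aff_n_plus\<close>
  and still reaches level 0. Finite codimension is then proved afresh: a thick ideal in
  \<open>aff_n_plus\<close> whose support meets level 0 contains all x \<otimes> t^k with k \<ge>
  2.\<close>

context lie_algebra
begin

lemma br_sum_right: "br x (sum v F) = (\<Sum>i\<in>F. br x (v i))"
  by (induction F rule: infinite_finite_induct) (simp_all add: br_add_right)

lemma br_minus_right: "br x (- y) = - br x y"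
  using br_add_right[of x y "- y"] by (simp add: eq_neg_iff_add_eq_0 add.commute)

lemma subspace_root_space: "subspace (root_space H \<alpha>)"
  by (auto simp: subspace_def root_space_def br_add_right br_scale_right scale_right_distrib
      mult.commute)

lemma zero_mem_dual [simp]: "(\<lambda>_. 0) \<in> dual H"
  by (simp add: dual_def)

text \<open>Forms in \<open>dual H\<close> vanish off \<open>H\<close>, so any difference between
  two of them must show on \<open>H\<close>.\<close>

lemma dual_separated:
  assumes "\<alpha> \<in> dual H" "\<beta> \<in> dual H" "\<alpha> \<noteq> \<beta>"
  shows "\<exists>h\<in>H. \<alpha> h \<noteq> \<beta> h"
proof (rule ccontr)
  assume "\<not> ?thesis"
  then have "\<alpha> x = \<beta> x" for x
    using assms(1,2) by (cases "x \<in> H") (auto simp: dual_def)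
  then show False using assms(3) by auto
qed

text \<open>Applying ad h - \<open>\<alpha>\<^sub>0 h\<close> to the sum kills the component of
  weight \<open>\<alpha>\<^sub>0\<close> and rescales the others, which leaves a shorter sum in
  \<open>I\<close>. For \<open>I\<close> = {0} this is the linear independence of vectors of
  distinct weights.\<close>

lemma weight_components_mem:
  assumes "finite F" "F \<subseteq> dual H" "subspace I"
    and stable: "\<And>h y. h \<in> H \<Longrightarrow> y \<in> I \<Longrightarrow> br h y \<in> I"
    and "\<And>\<alpha>. \<alpha> \<in> F \<Longrightarrow> v \<alpha> \<in> root_space H \<alpha>" "(\<Sum>\<alpha>\<in>F. v \<alpha>) \<in> I"
  shows "\<forall>\<alpha>\<in>F. v \<alpha> \<in> I"
  using assms(1,2,5,6)
proof (induction F arbitrary: v)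
  case empty
  then show ?case by simp
next
  case (insert \<alpha>\<^sub>0 F)
  have rest: "v \<beta> \<in> I" if \<beta>: "\<beta> \<in> F" for \<beta>
  proof -
    \<comment> \<open>\<open>h\<close> is chosen for this \<beta> alone. It may fail to separate
      \<open>\<alpha>\<^sub>0\<close> from other weights in \<open>F\<close>, which is harmless:
      only the \<beta>-component of the shorter sum is divided by its scalar.\<close>
    obtain h where h: "h \<in> H" "\<beta> h \<noteq> \<alpha>\<^sub>0 h"
      using dual_separated[of \<beta> H \<alpha>\<^sub>0] insert \<beta> by blast
    let ?s = "\<Sum>\<alpha>\<in>insert \<alpha>\<^sub>0 F. v \<alpha>"
    let ?w = "\<lambda>\<alpha>. (\<alpha> h - \<alpha>\<^sub>0 h) *s v \<alpha>"
    have "br h (v \<alpha>) = \<alpha> h *s v \<alpha>" if "\<alpha> \<in> insert \<alpha>\<^sub>0 F" for \<alpha>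
      using insert.prems(2)[OF that] h by (simp add: root_space_def)
    then have "br h ?s = (\<Sum>\<alpha>\<in>insert \<alpha>\<^sub>0 F. \<alpha> h *s v \<alpha>)"
      by (simp add: br_sum_right del: sum.insert)
    then have "br h ?s - \<alpha>\<^sub>0 h *s ?s = (\<Sum>\<alpha>\<in>insert \<alpha>\<^sub>0 F. ?w \<alpha>)"
      by (simp add: scale_sum_right scale_left_diff_distrib sum_subtractf del: sum.insert)
    also have "\<dots> = (\<Sum>\<alpha>\<in>F. ?w \<alpha>)"
      using insert.hyps by simp
    finally have "(\<Sum>\<alpha>\<in>F. ?w \<alpha>) \<in> I"
      using insert.prems(3) stable h assms(3) by (metis subspace_diff subspace_scale)
    then have "?w \<beta> \<in> I"
      using insert.IH[of ?w] insert.prems \<beta> subspace_scale[OF subspace_root_space] by auto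
    then have "inverse (\<beta> h - \<alpha>\<^sub>0 h) *s ?w \<beta> \<in> I"
      using assms(3) subspace_scale by blast
    then show ?thesis using h by simp
  qed
  have "v \<alpha>\<^sub>0 = (\<Sum>\<alpha>\<in>insert \<alpha>\<^sub>0 F. v \<alpha>) - (\<Sum>\<alpha>\<in>F. v \<alpha>)"
    using insert.hyps by simp
  also have "\<dots> \<in> I"
    using rest by (intro subspace_diff[OF assms(3) insert.prems(3)] subspace_sum[OF assms(3)])
  finally show ?case using rest by blast
qed

lemma span_root_spacesE:
  assumes "x \<in> span (\<Union>\<alpha>\<in>A. root_space H \<alpha>)"
  obtains F v where "finite F" "F \<subseteq> A" "\<And>\<alpha>. v \<alpha> \<in> root_space H \<alpha>" "x = (\<Sum>\<alpha>\<in>F. v \<alpha>)"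
proof -
  \<comment> \<open>Requiring \<open>v\<close> to vanish off \<open>F\<close> allows a new summand
    of weight \<alpha> to be merged in the same way whether or not \<alpha> is already in
    \<open>F\<close>.\<close>
  have "\<exists>F v. finite F \<and> F \<subseteq> A \<and> (\<forall>\<alpha>. v \<alpha> \<in> root_space H \<alpha>) \<and> (\<forall>\<alpha>. \<alpha> \<notin> F \<longrightarrow> v \<alpha> = 0) \<and>
      x = (\<Sum>\<alpha>\<in>F. v \<alpha>)"
    using assms
  proof (induction rule: span_induct_alt)
    case base
    show ?case
      by (rule exI[of _ "{}"], rule exI[of _ "\<lambda>_. 0"])
         (simp add: subspace_0[OF subspace_root_space])
  next
    case (step c a y)
    then obtain \<alpha> F v where *: "\<alpha> \<in> A" "a \<in> root_space H \<alpha>" "finite F" "F \<subseteq> A"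
      "\<forall>\<alpha>. v \<alpha> \<in> root_space H \<alpha>" "\<forall>\<alpha>. \<alpha> \<notin> F \<longrightarrow> v \<alpha> = 0" "y = (\<Sum>\<alpha>\<in>F. v \<alpha>)"
      by blast
    let ?v = "v(\<alpha> := c *s a + v \<alpha>)"
    have "(\<Sum>\<beta>\<in>insert \<alpha> F. ?v \<beta>) = ?v \<alpha> + (\<Sum>\<beta>\<in>F - {\<alpha>}. v \<beta>)"
      using *(3) by (subst sum.insert_remove) auto
    also have "\<dots> = c *s a + (\<Sum>\<beta>\<in>insert \<alpha> F. v \<beta>)"
      using *(3) by (subst sum.insert_remove) (auto simp: add.assoc)
    also have "(\<Sum>\<beta>\<in>insert \<alpha> F. v \<beta>) = y"
      unfolding *(7) using *(3,6) by (intro sum.mono_neutral_right) auto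
    finally have "c *s a + y = (\<Sum>\<beta>\<in>insert \<alpha> F. ?v \<beta>)" by simp
    moreover have "?v \<beta> \<in> root_space H \<beta>" for \<beta>
      using *(2,5) by (auto intro!: subspace_add subspace_scale subspace_root_space)
    ultimately show ?case
      using * by (intro exI[of _ "insert \<alpha> F"] exI[of _ ?v]) auto
  qed
  then show thesis using that by blast
qed

lemma stable_subspace_weight_span:
  assumes "subspace I" "\<And>h y. h \<in> H \<Longrightarrow> y \<in> I \<Longrightarrow> br h y \<in> I"
    and "A \<subseteq> dual H" "x \<in> I" "x \<in> span (\<Union>\<alpha>\<in>A. root_space H \<alpha>)"
  shows "x \<in> span (\<Union>\<alpha>\<in>A. I \<inter> root_space H \<alpha>)"
proof -
  obtain F v where F: "finite F" "F \<subseteq> A" "\<And>\<alpha>. v \<alpha> \<in> root_space H \<alpha>" "x = (\<Sum>\<alpha>\<in>F. v \<alpha>)"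
    using span_root_spacesE[OF assms(5)] by metis
  have "\<forall>\<alpha>\<in>F. v \<alpha> \<in> I"
    using assms F by (intro weight_components_mem[of F H I v]) auto
  then show ?thesis
    unfolding F(4) using F(2,3) by (intro span_sum span_base) blast
qed

text \<open>Moving \<open>x\<close> to the other side gives a vanishing sum of vectors of distinct
  weights, so \<open>weight_components_mem\<close> for the zero subspace applies.\<close>

lemma weight_vector_not_in_span:
  assumes "A \<subseteq> dual H" "\<beta> \<in> dual H" "\<beta> \<notin> A"
    and "x \<in> root_space H \<beta>" "x \<in> span (\<Union>\<alpha>\<in>A. root_space H \<alpha>)"
  shows "x = 0"
proof -
  obtain F v where F: "finite F" "F \<subseteq> A" "\<And>\<alpha>. v \<alpha> \<in> root_space H \<alpha>" "x = (\<Sum>\<alpha>\<in>F. v \<alpha>)"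
    using span_root_spacesE[OF assms(5)] by metis
  let ?v = "v(\<beta> := - x)"
  have "(\<Sum>\<alpha>\<in>F. ?v \<alpha>) = x"
    unfolding F(4) using F(2) assms(3) by (intro sum.cong) auto
  then have "(\<Sum>\<alpha>\<in>insert \<beta> F. ?v \<alpha>) = 0"
    using F assms(3) by (subst sum.insert) auto
  moreover have "?v \<alpha> \<in> root_space H \<alpha>" for \<alpha>
    using F(3) assms(4) by (auto intro: subspace_neg subspace_root_space)
  ultimately have "\<forall>\<alpha>\<in>insert \<beta> F. ?v \<alpha> \<in> {0}"
    using F assms by (intro weight_components_mem[of _ H]) auto
  then show ?thesis by simp
qed

text \<open>One nonzero vector from each root space gives a linearly independent family, and
  independent families are bounded by a finite spanning set.\<close>

lemma finite_roots:
  assumes finite_dim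
  shows "finite (roots H)"
proof -
  have "\<exists>x. x \<in> root_space H \<alpha> \<and> x \<noteq> 0" if "\<alpha> \<in> roots H" for \<alpha>
    using that subspace_0[OF subspace_root_space, of H \<alpha>] by (auto simp: roots_def)
  then obtain v where v: "\<And>\<alpha>. \<alpha> \<in> roots H \<Longrightarrow> v \<alpha> \<in> root_space H \<alpha> \<and> v \<alpha> \<noteq> 0"
    by metis
  have inj: "inj_on v (roots H)"
  proof (rule inj_onI, rule ccontr)
    fix \<alpha> \<beta> assume *: "\<alpha> \<in> roots H" "\<beta> \<in> roots H" "v \<alpha> = v \<beta>" "\<alpha> \<noteq> \<beta>"
    then have "v \<alpha> = 0"
      using v[of \<alpha>] v[of \<beta>]
      by (intro weight_vector_not_in_span[of "{\<beta>}" H \<alpha>]) (auto simp: roots_def intro: span_base)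
    then show False using v * by blast
  qed
  have "independent (v ` roots H)"
    unfolding independent_explicit_module
  proof (intro allI impI)
    fix T u w assume T: "finite T" "T \<subseteq> v ` roots H" "(\<Sum>w\<in>T. u w *s w) = 0" "w \<in> T"
    then obtain F where F: "finite F" "F \<subseteq> roots H" "T = v ` F"
      by (meson finite_subset_image)
    have "(\<Sum>\<alpha>\<in>F. u (v \<alpha>) *s v \<alpha>) = 0"
      using T(3) F inj by (simp add: sum.reindex inj_on_subset)
    then have "\<forall>\<alpha>\<in>F. u (v \<alpha>) *s v \<alpha> \<in> {0}"
      using F v by (intro weight_components_mem[of F H])
        (auto simp: roots_def intro!: subspace_scale subspace_root_space)
    then show "u w = 0" using T(4) F v by auto
  qed
  moreover obtain G where "finite G" "span G = UNIV"
    using assms by (auto simp: finite_dim_def)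
  ultimately have "finite (v ` roots H)"
    using independent_span_bound by blast
  then show ?thesis using inj finite_imageD by blast
qed

text \<open>The generators are taken inside \<open>W\<close> because \<open>finite_codim\<close>
  asks for generators inside the Borel subalgebra.\<close>

lemma finite_dim_subspace_finite_span:
  assumes finite_dim
  obtains E where "finite E" "E \<subseteq> W" "W \<subseteq> span E"
proof -
  obtain E where E: "E \<subseteq> W" "independent E" "W \<subseteq> span E"
    using maximal_independent_subset by blast
  obtain G where "finite G" "span G = UNIV"
    using assms by (auto simp: finite_dim_def)
  then have "finite E" using independent_span_bound E by blast
  then show thesis using E that by blast
qed

end

subsection \<open>Root vectors and the invariant form\<close>

context affine_datum
begin

text \<open>Adding the zero weight, whose space is \<open>H\<close>, lets the imaginary root spaces
  H \<otimes> t^n be indexed like the real ones.\<close>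

definition weights :: "('a \<Rightarrow> complex) set" where
  "weights = insert (\<lambda>_. 0) (roots H)"

lemma subspace_H: "subspace H"
  and br_H: "x \<in> H \<Longrightarrow> y \<in> H \<Longrightarrow> br x y = 0"
  and roots_eq: "roots H = Pos \<union> Neg"
  and Pos_Neg_disjoint: "Pos \<inter> Neg = {}"
  using triangular by (auto simp: triangular_decomposition_def)

lemma triangularE:
  obtains a h b where "a \<in> n_minus" "h \<in> H" "b \<in> n_plus" "x = a + h + b"
  using triangular unfolding triangular_decomposition_def by metis

lemma subspace_n_plus: "subspace n_plus"
  by (simp add: n_plus_def)

lemma roots_subset_dual: "roots H \<subseteq> dual H"
  by (auto simp: roots_def)

lemma weights_subset_dual: "weights \<subseteq> dual H"
  using roots_subset_dual by (auto simp: weights_def)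

lemma zero_not_root: "(\<lambda>_. 0) \<notin> roots H" "(\<lambda>_. 0) \<notin> Pos" "(\<lambda>_. 0) \<notin> Neg"
proof -
  show "(\<lambda>_. 0) \<notin> roots H" by (auto simp: roots_def)
  then show "(\<lambda>_. 0) \<notin> Pos" "(\<lambda>_. 0) \<notin> Neg" by (auto simp: roots_eq)
qed

lemma uminus_root: "\<gamma> \<in> roots H \<Longrightarrow> (\<lambda>x. - \<gamma> x) \<in> roots H"
  by (auto simp: roots_eq Neg_def)

lemma uminus_mem_Pos_iff: "\<gamma> \<in> roots H \<Longrightarrow> (\<lambda>x. - \<gamma> x) \<in> Pos \<longleftrightarrow> \<gamma> \<in> Neg"
  by (force simp: Neg_def)

lemma n_plus_plus_n_minus_subset_span_roots:
  assumes "a \<in> n_minus" "b \<in> n_plus"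
  shows "a + b \<in> span (\<Union>\<alpha>\<in>roots H. root_space H \<alpha>)"
proof (rule span_add)
  show "a \<in> span (\<Union>\<alpha>\<in>roots H. root_space H \<alpha>)"
    using assms(1) span_mono[of "\<Union>\<alpha>\<in>Neg. root_space H \<alpha>" "\<Union>\<alpha>\<in>roots H. root_space H \<alpha>"]
    by (auto simp: n_minus_def roots_eq)
  show "b \<in> span (\<Union>\<alpha>\<in>roots H. root_space H \<alpha>)"
    using assms(2) span_mono[of "\<Union>\<alpha>\<in>Pos. root_space H \<alpha>" "\<Union>\<alpha>\<in>roots H. root_space H \<alpha>"]
    by (auto simp: n_plus_def roots_eq)
qed

text \<open>Subtracting the \<open>H\<close>-component from a vector of weight zero leaves a vector
  of weight zero in the span of the root spaces, which must vanish.\<close>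

lemma root_space_zero: "root_space H (\<lambda>_. 0) = H"
proof
  show sub: "H \<subseteq> root_space H (\<lambda>_. 0)"
    using br_H by (auto simp: root_space_def)
  show "root_space H (\<lambda>_. 0) \<subseteq> H"
  proof
    fix x assume x: "x \<in> root_space H (\<lambda>_. 0)"
    obtain a h b where *: "a \<in> n_minus" "h \<in> H" "b \<in> n_plus" "x = a + h + b"
      by (rule triangularE)
    have "x - h \<in> root_space H (\<lambda>_. 0)"
      using x * sub by (intro subspace_diff[OF subspace_root_space]) auto
    moreover have "x - h \<in> span (\<Union>\<alpha>\<in>roots H. root_space H \<alpha>)"
      using n_plus_plus_n_minus_subset_span_roots * by simp
    ultimately have "x - h = 0"
      using zero_not_root roots_subset_dual zero_mem_dual
      by (intro weight_vector_not_in_span[of "roots H" H "\<lambda>_. 0" "x - h"])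
    then show "x \<in> H" using *(2) by simp
  qed
qed

text \<open>The triangular decomposition as an induction principle: a linear property need only be
  checked on weight vectors.\<close>

lemma subspace_weights_UNIV:
  assumes "subspace V" "\<And>\<gamma> x. \<gamma> \<in> weights \<Longrightarrow> x \<in> root_space H \<gamma> \<Longrightarrow> x \<in> V"
  shows "x \<in> V"
proof -
  obtain a h b where *: "a \<in> n_minus" "h \<in> H" "b \<in> n_plus" "x = a + h + b"
    by (rule triangularE)
  have "span (\<Union>\<alpha>\<in>roots H. root_space H \<alpha>) \<subseteq> V"
    using assms by (intro span_minimal) (auto simp: weights_def)
  then have "a + b \<in> V"
    using * n_plus_plus_n_minus_subset_span_roots by blast
  moreover have "h \<in> V"
    using *(2) assms(2)[of "\<lambda>_. 0"] by (simp add: root_space_zero weights_def)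
  ultimately have "a + b + h \<in> V"
    by (rule subspace_add[OF assms(1)])
  also have "a + b + h = x" using * by (simp add: add_ac)
  finally show ?thesis .
qed

text \<open>Without roots the algebra would equal \<open>H\<close> and be abelian, which
  \<open>simple\<close> excludes.\<close>

lemma roots_nonempty: "roots H \<noteq> {}"
proof
  assume "roots H = {}"
  then have "weights = {\<lambda>_. 0}" by (simp add: weights_def)
  then have "x \<in> H" for x
    using subspace_weights_UNIV[OF subspace_H, of x] by (simp add: root_space_zero)
  then have "br x y = 0" for x y
    using br_H by blast
  then show False using simple unfolding simple_def by blast
qed

lemma Pos_nonempty: "Pos \<noteq> {}"
  using roots_nonempty by (auto simp: roots_eq Neg_def)

lemma root_nonzero_on_H:
  assumes "\<gamma> \<in> roots H"
  obtains h where "h \<in> H" "\<gamma> h \<noteq> 0"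
  using dual_separated[of \<gamma> H "\<lambda>_. 0"] assms by (auto simp: roots_def)

lemma weight_vector_exists:
  assumes "\<gamma> \<in> weights"
  obtains x where "x \<in> root_space H \<gamma>" "x \<noteq> 0"
proof -
  have "\<exists>x. x \<in> root_space H \<gamma> \<and> x \<noteq> 0"
  proof (cases "\<gamma> \<in> roots H")
    case True
    then show ?thesis
      using subspace_0[OF subspace_root_space, of H \<gamma>] by (auto simp: roots_def)
  next
    case False
    \<comment> \<open>The zero weight needs \<open>H\<close> to be nonzero: some root takes a
      nonzero value at an element of \<open>H\<close>, and a form vanishes at 0.\<close>
    obtain \<beta> where \<beta>: "\<beta> \<in> roots H" using roots_nonempty by blast
    obtain h where h: "h \<in> H" "\<beta> h \<noteq> 0" using root_nonzero_on_H[OF \<beta>] .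
    have "\<beta> (0 *s h) = 0 * \<beta> h"
      using \<beta> h by (simp add: roots_def dual_def del: scale_zero_left)
    then have "h \<noteq> 0" using h by auto
    then show ?thesis using h False assms by (auto simp: weights_def root_space_zero)
  qed
  then show thesis using that by blast
qed

lemma form_minus: "form (- x) y = - form x y"
  using form_scale[of "-1" x y] by simp

text \<open>By invariance the form pairs weight spaces nontrivially only when their weights are
  opposite. A vector orthogonal to the opposite root space would thus be orthogonal to
  everything.\<close>

lemma form_root_pairing:
  assumes "\<gamma> \<in> roots H" "e \<in> root_space H \<gamma>" "e \<noteq> 0"
  obtains f where "f \<in> root_space H (\<lambda>x. - \<gamma> x)" "form e f \<noteq> 0"
proof -
  have "\<exists>f\<in>root_space H (\<lambda>x. - \<gamma> x). form e f \<noteq> 0"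
  proof (rule ccontr)
    assume neg: "\<not> ?thesis"
    have "y \<in> {y. form e y = 0}" for y
    proof (rule subspace_weights_UNIV)
      show "subspace {y. form e y = 0}"
        by (auto simp: subspace_def form_add_right form_scale_right)
      fix \<beta> y assume \<beta>: "\<beta> \<in> weights" "y \<in> root_space H \<beta>"
      show "y \<in> {y. form e y = 0}"
      proof (cases "\<beta> = (\<lambda>x. - \<gamma> x)")
        case True
        then show ?thesis using \<beta> neg by auto
      next
        case False
        have "(\<lambda>x. - \<gamma> x) \<in> dual H"
          using uminus_root[OF assms(1)] by (simp add: roots_def)
        then obtain h where h: "h \<in> H" "\<beta> h \<noteq> - \<gamma> h"
          using dual_separated[of \<beta> H "\<lambda>x. - \<gamma> x"] False \<beta>(1) weights_subset_dual by blast
        have "form (br e h) y = form e (br h y)" by (rule form_invariant)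
        then have "- (\<gamma> h * form e y) = \<beta> h * form e y"
          using assms(2) \<beta>(2) h
          by (simp add: br_minus[of e h] root_space_def form_scale_right form_minus form_scale)
        then have "(\<beta> h + \<gamma> h) * form e y = 0" by (metis add.left_inverse distrib_right)
        then show ?thesis using h by (simp add: eq_neg_iff_add_eq_0)
      qed
    qed
    then show False using form_nondegenerate assms(3) by blast
  qed
  then show thesis using that by blast
qed

text \<open>Invariance gives form([e, f], h) = \<gamma>(h) form(e, f), which is nonzero for suitable
  f and h. By the Jacobi identity the bracket has weight zero, hence lies in
  \<open>H\<close>.\<close>

lemma opposite_root_vectors_br:
  assumes "\<gamma> \<in> roots H" "e \<in> root_space H \<gamma>" "e \<noteq> 0"
  obtains f where "f \<in> root_space H (\<lambda>x. - \<gamma> x)" "br f e \<in> H" "br f e \<noteq> 0"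
proof -
  obtain f where f: "f \<in> root_space H (\<lambda>x. - \<gamma> x)" "form e f \<noteq> 0"
    using form_root_pairing[OF assms] .
  obtain h where h: "h \<in> H" "\<gamma> h \<noteq> 0" using root_nonzero_on_H[OF assms(1)] .
  have "form (br e f) h = form e (br f h)" by (rule form_invariant)
  also have "\<dots> = \<gamma> h * form e f"
    using f h by (simp add: br_minus[of f h] root_space_def form_scale_right)
  finally have "br e f \<noteq> 0" using f h by auto
  then have "br f e \<noteq> 0" by (simp add: br_minus[of f e])
  moreover have "br f e \<in> root_space H (\<lambda>_. 0)"
  proof -
    have "br h (br f e) = 0" if "h \<in> H" for h
    proof -
      have "br h f = - \<gamma> h *s f" "br e h = - \<gamma> h *s e"
        using assms(2) f that by (auto simp: root_space_def br_minus[of e h])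
      moreover have "br h (br f e) + br f (br e h) + br e (br h f) = 0" by (rule jacobi)
      ultimately show ?thesis
        by (simp add: br_scale_right br_minus_right br_minus[of e f])
    qed
    then show ?thesis by (simp add: root_space_def)
  qed
  ultimately show thesis using f that root_space_zero by blast
qed

subsection \<open>Affine roots and root spaces\<close>

definition loop_elt :: "int \<Rightarrow> 'a \<Rightarrow> 'a affine" where
  "loop_elt n x = (Poly_Mapping.single n x, 0, 0)"

lemma loop_elt_eq_iff [simp]: "loop_elt n x = loop_elt n y \<longleftrightarrow> x = y"
  by (auto simp: loop_elt_def dest: injD[OF inj_single])

lemma loop_elt_0 [simp]: "loop_elt n 0 = 0"
  by (simp add: loop_elt_def zero_prod_def)

lemma loop_elt_eq_0_iff [simp]: "loop_elt n x = 0 \<longleftrightarrow> x = 0"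
  by (metis loop_elt_0 loop_elt_eq_iff)

lemma loop_elt_add: "loop_elt n (x + y) = loop_elt n x + loop_elt n y"
  by (simp add: loop_elt_def single_add)

lemma loop_elt_scale: "loop_elt n (c *s x) = aff_scale c (loop_elt n x)"
  by (simp add: loop_elt_def aff_scale_def map_scale_single)

text \<open>Combined with \<open>subspace_weights_UNIV\<close>, this reduces the membership of x
  \<otimes> t^n in a subspace to weight vectors x.\<close>

lemma subspace_loop_elt_vimage:
  assumes "aff.subspace V"
  shows "subspace {x. loop_elt n x \<in> V}"
  using assms by (auto simp: subspace_def aff.subspace_def loop_elt_add loop_elt_scale)

lemma sum_loop_elt: "(\<Sum>k\<in>Poly_Mapping.keys f. loop_elt k (Poly_Mapping.lookup f k)) = (f, 0, 0)"
proof -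
  have "(\<Sum>k\<in>Poly_Mapping.keys f. Poly_Mapping.single k (Poly_Mapping.lookup f k)) = f"
    by (rule poly_mapping_eqI) (auto simp: lookup_sum lookup_single when_def in_keys_iff)
  moreover have "(\<Sum>k\<in>K. loop_elt k (g k)) = (\<Sum>k\<in>K. Poly_Mapping.single k (g k), 0, 0)" for K g
    by (induction K rule: infinite_finite_induct) (simp_all add: loop_elt_def zero_prod_def)
  ultimately show ?thesis by simp
qed

lemma map_scale_zero [simp]: "Poly_Mapping.map (scale c) 0 = (0 :: int \<Rightarrow>\<^sub>0 'a)"
  by (rule poly_mapping_eqI) (simp add: lookup_map_scale)

text \<open>The central term requires k + l = 0, hence k = l = 0 here, and it carries the factor
  k.\<close>

lemma aff_br_loop_elt:
  "k \<ge> 0 \<Longrightarrow> l \<ge> 0 \<Longrightarrow> aff_br (loop_elt k x) (loop_elt l y) = loop_elt (k + l) (br x y)"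
  by (auto simp: loop_elt_def aff_br_gen)

text \<open>Once the inner sum is eliminated, \<open>g\<close> enters only through degree n - k, so
  the effect of multiplying \<open>g\<close> by a power of t can be read off.\<close>

lemma lookup_loop_br:
  "Poly_Mapping.lookup (loop_br f g) n =
    (\<Sum>k\<in>Poly_Mapping.keys f. br (Poly_Mapping.lookup f k) (Poly_Mapping.lookup g (n - k)))"
proof -
  have "(\<Sum>l\<in>Poly_Mapping.keys g. br x (Poly_Mapping.lookup g l) when k + l = n) =
      br x (Poly_Mapping.lookup g (n - k))" for k x
  proof -
    have "(k + l = n) = (l = n - k)" for l by auto
    then show ?thesis
      by (auto simp: when_def sum.delta in_keys_iff)
  qed
  then show ?thesis
    by (simp add: loop_br_def lookup_sum lookup_single)
qed

lemma lookup_loop_br_single_zero: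
  "Poly_Mapping.lookup (loop_br (Poly_Mapping.single 0 h) g) n = br h (Poly_Mapping.lookup g n)"
  by (auto simp: lookup_loop_br)

lemma aff_br_aff_H:
  "aff_br (Poly_Mapping.single 0 h, a, b) (f, a', b') =
    (loop_br (Poly_Mapping.single 0 h) f + Poly_Mapping.map (scale b) (degree_der f), 0, 0)"
  by (simp add: aff_br_def degree_der_single cocycle_def)

text \<open>The affine weight \<gamma> + n \<delta>; for \<gamma> = 0 it is the imaginary weight n
  \<delta>.\<close>

definition wt :: "('a \<Rightarrow> complex) \<Rightarrow> int \<Rightarrow> 'a affine \<Rightarrow> complex" where
  "wt \<gamma> n = shift n (ext \<gamma>)"

lemma wt_apply: "h \<in> H \<Longrightarrow> wt \<gamma> n (Poly_Mapping.single 0 h, a, b) = \<gamma> h + of_int n * b"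
  by (auto simp: wt_def shift_def ext_def delta_def aff_H_def)

lemma wt_outside: "X \<notin> aff_H \<Longrightarrow> wt \<gamma> n X = 0"
  by (auto simp: wt_def shift_def ext_def delta_def)

lemma shift_wt: "shift k (wt \<gamma> n) = wt \<gamma> (n + k)"
  by (simp add: wt_def add.commute)

lemma wt_zero_one: "wt (\<lambda>_. 0) 1 = delta"
  by (auto simp: wt_def shift_def ext_def)

lemma wt_mem_dual: "\<gamma> \<in> dual H \<Longrightarrow> wt \<gamma> n \<in> aff.dual aff_H"
proof -
  assume \<gamma>: "\<gamma> \<in> dual H"
  have "wt \<gamma> n (X + Y) = wt \<gamma> n X + wt \<gamma> n Y" if XY: "X \<in> aff_H" "Y \<in> aff_H" for X Y
  proof -
    obtain h a b h' a' b' where *: "X = (Poly_Mapping.single 0 h, a, b)" "h \<in> H"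
      "Y = (Poly_Mapping.single 0 h', a', b')" "h' \<in> H"
      using XY by (auto simp: aff_H_def)
    have "h + h' \<in> H" using * subspace_add subspace_H by blast
    moreover have "\<gamma> (h + h') = \<gamma> h + \<gamma> h'" using \<gamma> * by (simp add: dual_def)
    ultimately show ?thesis using * by (simp add: wt_apply distrib_left flip: single_add)
  qed
  moreover have "wt \<gamma> n (aff_scale c X) = c * wt \<gamma> n X" if X: "X \<in> aff_H" for c X
  proof -
    obtain h a b where *: "X = (Poly_Mapping.single 0 h, a, b)" "h \<in> H"
      using X by (auto simp: aff_H_def)
    have "c *s h \<in> H" using * subspace_scale subspace_H by blast
    moreover have "\<gamma> (c *s h) = c * \<gamma> h" using \<gamma> * by (simp add: dual_def)
    ultimately show ?thesis
      using * by (simp add: wt_apply aff_scale_def map_scale_single distrib_left)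
  qed
  ultimately show ?thesis by (auto simp: aff.dual_def wt_outside)
qed

lemma wt_eq_iff:
  assumes "\<gamma> \<in> dual H" "\<gamma>' \<in> dual H"
  shows "wt \<gamma> n = wt \<gamma>' n' \<longleftrightarrow> \<gamma> = \<gamma>' \<and> n = n'"
proof
  assume eq: "wt \<gamma> n = wt \<gamma>' n'"
  have "\<gamma> h = \<gamma>' h" if "h \<in> H" for h
    using fun_cong[OF eq, of "(Poly_Mapping.single 0 h, 0, 0)"] that by (simp add: wt_apply)
  then have "\<gamma> = \<gamma>'" using dual_separated assms by blast
  moreover have "n = n'"
  proof -
    have "0 \<in> H" by (rule subspace_0[OF subspace_H])
    then show ?thesis
      using fun_cong[OF eq, of "(Poly_Mapping.single 0 0, 0, 1)"] \<open>\<gamma> = \<gamma>'\<close>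
        wt_apply[of 0 _ _ 0 1] by simp
  qed
  ultimately show "\<gamma> = \<gamma>' \<and> n = n'" ..
qed simp

lemma wt_eq_zero_iff:
  assumes "\<gamma> \<in> dual H"
  shows "wt \<gamma> n = (\<lambda>_. 0) \<longleftrightarrow> \<gamma> = (\<lambda>_. 0) \<and> n = 0"
proof -
  have "wt (\<lambda>_. 0) 0 = (\<lambda>_. 0)" by (auto simp: wt_def ext_def)
  then show ?thesis using wt_eq_iff[OF assms zero_mem_dual, of n 0] by simp
qed

text \<open>A bracket with an element of \<open>aff_H\<close> has no c- or d-component, so a vector
  of nonzero weight has none either. What remains is the weight equation in each degree
  separately.\<close>

lemma aff_root_space_nonzeroD:
  assumes "X \<in> aff_root_space \<alpha>" "\<alpha> \<in> aff.dual aff_H" "\<alpha> \<noteq> (\<lambda>_. 0)"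
  obtains f where "X = (f, 0, 0)"
    "\<And>h a b k. h \<in> H \<Longrightarrow> br h (Poly_Mapping.lookup f k) + (b * of_int k) *s Poly_Mapping.lookup f k =
        \<alpha> (Poly_Mapping.single 0 h, a, b) *s Poly_Mapping.lookup f k"
proof -
  obtain f a b where X: "X = (f, a, b)" by (cases X)
  have *: "aff_br (Poly_Mapping.single 0 h, a', b') X =
      aff_scale (\<alpha> (Poly_Mapping.single 0 h, a', b')) X" if "h \<in> H" for h a' b'
    using assms(1) that by (auto simp: aff.root_space_def aff_H_def)
  obtain Y where Y: "Y \<in> aff_H" "\<alpha> Y \<noteq> 0"
    using aff.dual_separated[OF assms(2) aff.zero_mem_dual assms(3)] by blast
  then have "a = 0" "b = 0"
    using * by (auto simp: aff_H_def X aff_br_aff_H aff_scale_def)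
  moreover have "br h (Poly_Mapping.lookup f k) + (b' * of_int k) *s Poly_Mapping.lookup f k =
      \<alpha> (Poly_Mapping.single 0 h, a', b') *s Poly_Mapping.lookup f k" if "h \<in> H" for h a' b' k
  proof -
    have "Poly_Mapping.lookup (fst (aff_br (Poly_Mapping.single 0 h, a', b') X)) k =
      Poly_Mapping.lookup (fst (aff_scale (\<alpha> (Poly_Mapping.single 0 h, a', b')) X)) k"
      using *[OF that] by simp
    then show ?thesis
      by (simp add: X aff_br_aff_H aff_scale_def lookup_add lookup_map_scale lookup_degree_der
          lookup_loop_br_single_zero)
  qed
  ultimately show thesis using X that by blast
qed

text \<open>The action of d fixes the degree and that of \<open>H\<close> fixes the weight of the
  coefficient. The excluded case is the zero weight, whose space is \<open>aff_H\<close> and so also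
  contains c and d.\<close>

lemma aff_root_space_wt:
  assumes \<gamma>: "\<gamma> \<in> dual H" and nz: "\<gamma> \<noteq> (\<lambda>_. 0) \<or> n \<noteq> 0"
  shows "aff_root_space (wt \<gamma> n) = loop_elt n ` root_space H \<gamma>"
proof
  show "aff_root_space (wt \<gamma> n) \<subseteq> loop_elt n ` root_space H \<gamma>"
  proof
    fix X assume "X \<in> aff_root_space (wt \<gamma> n)"
    then obtain f where f: "X = (f, 0, 0)"
      "\<And>h a b k. h \<in> H \<Longrightarrow> br h (Poly_Mapping.lookup f k) + (b * of_int k) *s Poly_Mapping.lookup f k =
        wt \<gamma> n (Poly_Mapping.single 0 h, a, b) *s Poly_Mapping.lookup f k"
      using aff_root_space_nonzeroD[OF _ wt_mem_dual[OF \<gamma>]] nz wt_eq_zero_iff[OF \<gamma>] by metis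
    have 0: "0 \<in> H" by (rule subspace_0[OF subspace_H])
    have g0: "\<gamma> 0 = 0" using \<gamma> 0 unfolding dual_def by (metis (mono_tags, lifting) mem_Collect_eq mult_zero_left scale_zero_left)
    \<comment> \<open>The weight equation tested at d: the coefficient in degree k is multiplied by
      k on one side and by n on the other.\<close>
    have "Poly_Mapping.lookup f k = 0" if "k \<noteq> n" for k
      using f(2)[OF 0, of k 1 0] wt_apply[OF 0, of \<gamma> n 0 1] g0 that by simp
    then have "f = Poly_Mapping.single n (Poly_Mapping.lookup f n)"
      by (intro poly_mapping_eqI) (auto simp: lookup_single when_def)
    moreover have "Poly_Mapping.lookup f n \<in> root_space H \<gamma>"
      using f(2)[where b = 0] by (auto simp: root_space_def wt_apply)
    ultimately show "X \<in> loop_elt n ` root_space H \<gamma>"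
      using f(1) by (auto simp: loop_elt_def)
  qed
  show "loop_elt n ` root_space H \<gamma> \<subseteq> aff_root_space (wt \<gamma> n)"
    by (auto simp: aff.root_space_def root_space_def aff_H_def loop_elt_def aff_br_aff_H
        loop_br_single degree_der_single map_scale_single wt_apply aff_scale_def
        scale_left_distrib mult.commute simp flip: single_add)
qed

lemma aff_roots_eq:
  "aff_roots = {wt \<gamma> n |\<gamma> n. \<gamma> \<in> weights \<and> (\<gamma> \<noteq> (\<lambda>_. 0) \<or> n \<noteq> 0)}"
proof (intro equalityI subsetI)
  fix \<alpha> assume "\<alpha> \<in> aff_roots"
  then have \<alpha>: "\<alpha> \<in> aff.dual aff_H" "\<alpha> \<noteq> (\<lambda>_. 0)" "aff_root_space \<alpha> \<noteq> {0}"
    by (auto simp: aff.roots_def)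
  obtain X where X: "X \<in> aff_root_space \<alpha>" "X \<noteq> 0"
    using \<alpha>(3) aff.subspace_0[OF aff.subspace_root_space, of aff_H \<alpha>] by blast
  obtain f where f: "X = (f, 0, 0)"
    "\<And>h a b k. h \<in> H \<Longrightarrow> br h (Poly_Mapping.lookup f k) + (b * of_int k) *s Poly_Mapping.lookup f k =
        \<alpha> (Poly_Mapping.single 0 h, a, b) *s Poly_Mapping.lookup f k"
    using aff_root_space_nonzeroD[OF X(1) \<alpha>(1,2)] by blast
  obtain k where k: "Poly_Mapping.lookup f k \<noteq> 0"
    using X(2) f(1) by (metis poly_mapping_eqI lookup_zero zero_prod_def)
  let ?x = "Poly_Mapping.lookup f k"
  \<comment> \<open>\<gamma> is the restriction of \<alpha> to H \<otimes> 1. The multiple of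
    \<delta> is the degree k of a nonzero coefficient, since d acts there by k.\<close>
  define \<gamma> where "\<gamma> = (\<lambda>h. \<alpha> (loop_elt 0 h))"
  have mem: "loop_elt 0 h \<in> aff_H \<longleftrightarrow> h \<in> H" for h
    by (auto simp: loop_elt_def aff_H_def dest: injD[OF inj_single])
  have \<gamma>: "\<gamma> \<in> dual H"
    using \<alpha>(1) by (simp add: dual_def aff.dual_def \<gamma>_def loop_elt_add loop_elt_scale mem
        del: split_paired_All)
  have x: "br h ?x = \<gamma> h *s ?x" if "h \<in> H" for h
    using f(2)[OF that, of k 0 0] by (simp add: \<gamma>_def loop_elt_def)
  have "\<gamma> \<in> weights"
    using \<gamma> x k by (auto simp: weights_def roots_def root_space_def)
  moreover have \<alpha>_eq: "\<alpha> = wt \<gamma> k"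
  proof
    fix Y
    show "\<alpha> Y = wt \<gamma> k Y"
    proof (cases "Y \<in> aff_H")
      case True
      then obtain h a b where Y: "Y = (Poly_Mapping.single 0 h, a, b)" "h \<in> H"
        by (auto simp: aff_H_def)
      have "(\<gamma> h + b * of_int k) *s ?x = \<alpha> Y *s ?x"
        using f(2)[OF Y(2), of k b a] x[OF Y(2)] Y(1) by (simp add: scale_left_distrib)
      then show ?thesis using k Y by (simp add: wt_apply mult.commute)
    next
      case False
      then show ?thesis
        using \<alpha>(1) by (simp add: wt_outside aff.dual_def del: split_paired_All)
    qed
  qed
  ultimately show "\<alpha> \<in> {wt \<gamma> n |\<gamma> n. \<gamma> \<in> weights \<and> (\<gamma> \<noteq> (\<lambda>_. 0) \<or> n \<noteq> 0)}"
    using \<alpha>(2) wt_eq_zero_iff[OF \<gamma>] by blast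
next
  fix \<alpha> assume "\<alpha> \<in> {wt \<gamma> n |\<gamma> n. \<gamma> \<in> weights \<and> (\<gamma> \<noteq> (\<lambda>_. 0) \<or> n \<noteq> 0)}"
  then obtain \<gamma> n where *: "\<alpha> = wt \<gamma> n" "\<gamma> \<in> weights" "\<gamma> \<noteq> (\<lambda>_. 0) \<or> n \<noteq> 0" by blast
  have \<gamma>: "\<gamma> \<in> dual H" using * weights_subset_dual by blast
  obtain x where "x \<in> root_space H \<gamma>" "x \<noteq> 0" using weight_vector_exists[OF *(2)] .
  then have "loop_elt n x \<in> aff_root_space \<alpha>" "loop_elt n x \<noteq> 0"
    using * aff_root_space_wt[OF \<gamma> *(3)] by auto
  then have "aff_root_space \<alpha> \<noteq> {0}" by blast
  then show "\<alpha> \<in> aff_roots"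
    using * wt_mem_dual[OF \<gamma>] wt_eq_zero_iff[OF \<gamma>] by (auto simp: aff.roots_def)
qed

section \<open>The subalgebras \<open>aff_n_plus\<close> and \<open>aff_borel\<close> in
  coordinates\<close>

lemma aff_n_plus_eq:
  "aff_n_plus = {(f, 0, 0) |f. (\<forall>k<0. Poly_Mapping.lookup f k = 0) \<and> Poly_Mapping.lookup f 0 \<in> n_plus}"
    (is "_ = ?N")
proof
  have "aff.subspace ?N"
    using subspace_n_plus
    by (auto simp: aff.subspace_def subspace_def zero_prod_def aff_scale_def lookup_add
        lookup_map_scale)
  moreover have "0 \<in> n_plus" by (rule subspace_0[OF subspace_n_plus])
  ultimately show "aff_n_plus \<subseteq> ?N"
    unfolding aff_n_plus_def by (intro aff.span_minimal) (auto simp: lookup_single when_def)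
  show "?N \<subseteq> aff_n_plus"
  proof
    fix X assume "X \<in> ?N"
    then obtain f where f: "X = (f, 0, 0)" "\<forall>k<0. Poly_Mapping.lookup f k = 0"
      "Poly_Mapping.lookup f 0 \<in> n_plus" by blast
    have "loop_elt k (Poly_Mapping.lookup f k) \<in> aff_n_plus" if "k \<in> Poly_Mapping.keys f" for k
    proof -
      have "k > 0 \<or> k = 0" using f(2) that by (metis in_keys_iff linorder_neqE_linordered_idom)
      then show ?thesis
        using f(3) unfolding aff_n_plus_def loop_elt_def by (auto intro!: aff.span_base)
    qed
    then have "(\<Sum>k\<in>Poly_Mapping.keys f. loop_elt k (Poly_Mapping.lookup f k)) \<in> aff_n_plus"
      unfolding aff_n_plus_def by (intro aff.span_sum)
    then show "X \<in> aff_n_plus" using f(1) by (simp add: sum_loop_elt)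
  qed
qed

lemma aff_borel_eq:
  "aff_borel = {(f, a, b) |f a b. (\<forall>k<0. Poly_Mapping.lookup f k = 0) \<and>
     Poly_Mapping.lookup f 0 \<in> {h + x |h x. h \<in> H \<and> x \<in> n_plus}}" (is "_ = ?B")
proof
  show "aff_borel \<subseteq> ?B"
    by (force simp: aff_borel_def aff_H_def aff_n_plus_eq lookup_add lookup_single)
  show "?B \<subseteq> aff_borel"
  proof
    fix X assume "X \<in> ?B"
    then obtain f a b h x where *: "X = (f, a, b)" "\<forall>k<0. Poly_Mapping.lookup f k = 0"
      "Poly_Mapping.lookup f 0 = h + x" "h \<in> H" "x \<in> n_plus" by blast
    let ?h = "Poly_Mapping.single 0 h"
    have "(?h, a, b) \<in> aff_H" using * by (auto simp: aff_H_def)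
    moreover have "(f - ?h, 0, 0) \<in> aff_n_plus"
      using * by (simp add: aff_n_plus_eq lookup_minus lookup_single)
    moreover have "X = (?h, a, b) + (f - ?h, 0, 0)" using * by simp
    ultimately show "X \<in> aff_borel" unfolding aff_borel_def by blast
  qed
qed

lemma aff_H_subset_aff_borel: "aff_H \<subseteq> aff_borel"
proof
  fix X assume "X \<in> aff_H"
  moreover have "0 \<in> aff_n_plus" unfolding aff_n_plus_def by (rule aff.span_zero)
  ultimately show "X \<in> aff_borel"
    unfolding aff_borel_def by (metis (mono_tags, lifting) add.right_neutral mem_Collect_eq)
qed

lemma loop_elt_mem_aff_borel:
  assumes "n > 0 \<or> n = 0 \<and> (x \<in> H \<or> x \<in> n_plus)"
  shows "loop_elt n x \<in> aff_borel"
proof -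
  have "0 \<in> H" "0 \<in> n_plus"
    using subspace_0 subspace_H subspace_n_plus by blast+
  then have "0 \<in> {h + x |h x. h \<in> H \<and> x \<in> n_plus}"
    and "x \<in> H \<or> x \<in> n_plus \<Longrightarrow> x \<in> {h + x |h x. h \<in> H \<and> x \<in> n_plus}"
    by force+
  then show ?thesis
    using assms unfolding loop_elt_def aff_borel_eq by (auto simp: lookup_single when_def)
qed

lemma root_space_Pos_subset: "\<gamma> \<in> Pos \<Longrightarrow> root_space H \<gamma> \<subseteq> n_plus"
  unfolding n_plus_def by (auto intro: span_base)

lemma loop_elt_mem_aff_n_plus:
  "loop_elt n x \<in> aff_n_plus \<longleftrightarrow> x = 0 \<or> n > 0 \<or> n = 0 \<and> x \<in> n_plus"
proof -
  have "0 \<in> n_plus" by (rule subspace_0[OF subspace_n_plus])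
  then show ?thesis
    by (cases "n < 0"; cases "n = 0") (auto simp: loop_elt_def aff_n_plus_eq lookup_single when_def)
qed

section \<open>Levels and positive affine roots\<close>

definition level :: "('a \<Rightarrow> complex) \<Rightarrow> int \<Rightarrow> int" where
  "level \<gamma> n = (if \<gamma> \<in> Pos then n else n - 1)"

lemma level_shift: "level \<gamma> (n + k) = level \<gamma> n + k"
  by (simp add: level_def)

text \<open>By independence of weight spaces, a nonzero weight vector lies in \<open>n_plus\<close>
  exactly when its weight is in \<open>Pos\<close>. This decides degree 0 and accounts for the
  offset in \<open>level\<close>.\<close>

lemma loop_elt_weight_vector_mem_aff_n_plus:
  assumes "\<gamma> \<in> weights" "x \<in> root_space H \<gamma>" "x \<noteq> 0"
  shows "loop_elt n x \<in> aff_n_plus \<longleftrightarrow> level \<gamma> n \<ge> 0"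
proof -
  have "x \<in> n_plus \<longleftrightarrow> \<gamma> \<in> Pos"
    using assms weight_vector_not_in_span[of Pos H \<gamma> x] weights_subset_dual
      root_space_Pos_subset[of \<gamma>] zero_not_root by (auto simp: n_plus_def roots_eq weights_def)
  then show ?thesis using assms by (auto simp: loop_elt_mem_aff_n_plus level_def)
qed

lemma D_eq: "D k = {wt \<gamma> n |\<gamma> n. \<gamma> \<in> weights \<and> level \<gamma> n = int k}"
proof -
  have "D k = {wt \<gamma> (int k) |\<gamma>. \<gamma> \<in> Pos} \<union> {wt (\<lambda>_. 0) (1 + int k)} \<union>
      {wt \<gamma> (1 + int k) |\<gamma>. \<gamma> \<in> Neg}"
  proof -
    have "ext = (\<lambda>\<gamma>. wt \<gamma> 0)" by (simp add: wt_def)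
    then have "D k = shift (int k) `
        ((\<lambda>\<gamma>. wt \<gamma> 0) ` Pos \<union> {wt (\<lambda>_. 0) 1} \<union> (\<lambda>\<gamma>. wt \<gamma> 1) ` Neg)"
      unfolding D_def by (simp add: Setcompr_eq_image wt_zero_one shift_wt)
    then show ?thesis by (simp add: image_Un image_image shift_wt Setcompr_eq_image)
  qed
  also have "\<dots> = {wt \<gamma> n |\<gamma> n. \<gamma> \<in> weights \<and> level \<gamma> n = int k}"
  proof (intro equalityI subsetI)
    fix \<alpha> assume "\<alpha> \<in> {wt \<gamma> n |\<gamma> n. \<gamma> \<in> weights \<and> level \<gamma> n = int k}"
    then obtain \<gamma> n where *: "\<alpha> = wt \<gamma> n" "\<gamma> \<in> weights" "level \<gamma> n = int k" by blast
    then have "n = (if \<gamma> \<in> Pos then int k else 1 + int k)"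
      by (auto simp: level_def split: if_splits)
    with * show "\<alpha> \<in> {wt \<gamma> (int k) |\<gamma>. \<gamma> \<in> Pos} \<union> {wt (\<lambda>_. 0) (1 + int k)} \<union>
      {wt \<gamma> (1 + int k) |\<gamma>. \<gamma> \<in> Neg}"
      by (auto simp: weights_def roots_eq split: if_splits)
  next
    fix \<alpha> assume "\<alpha> \<in> {wt \<gamma> (int k) |\<gamma>. \<gamma> \<in> Pos} \<union> {wt (\<lambda>_. 0) (1 + int k)} \<union>
      {wt \<gamma> (1 + int k) |\<gamma>. \<gamma> \<in> Neg}"
    then consider \<gamma> where "\<alpha> = wt \<gamma> (int k)" "\<gamma> \<in> Pos"
      | \<gamma> where "\<alpha> = wt \<gamma> (1 + int k)" "\<gamma> \<in> weights" "\<gamma> \<notin> Pos"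
      using Pos_Neg_disjoint zero_not_root unfolding weights_def roots_eq by blast
    then show "\<alpha> \<in> {wt \<gamma> n |\<gamma> n. \<gamma> \<in> weights \<and> level \<gamma> n = int k}"
    proof cases
      case 1
      then have "\<gamma> \<in> weights" "level \<gamma> (int k) = int k"
        by (simp_all add: level_def weights_def roots_eq)
      then show ?thesis using 1 by blast
    next
      case 2
      then have "level \<gamma> (1 + int k) = int k" by (simp add: level_def)
      then show ?thesis using 2 by blast
    qed
  qed
  finally show ?thesis .
qed

definition aff_pos_roots :: "('a affine \<Rightarrow> complex) set" where
  "aff_pos_roots = {wt \<gamma> n |\<gamma> n. \<gamma> \<in> weights \<and> level \<gamma> n \<ge> 0}"

text \<open>The zero weight in degree 0 has level -1, so a nonnegative level excludes the one pair
  that is not a root.\<close>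

lemma level_nonneg_nonzero: "level \<gamma> n \<ge> 0 \<Longrightarrow> \<gamma> \<noteq> (\<lambda>_. 0) \<or> n \<noteq> 0"
  using zero_not_root by (auto simp: level_def)

lemma aff_pos_roots_subset_dual: "aff_pos_roots \<subseteq> aff.dual aff_H"
  using weights_subset_dual by (auto simp: aff_pos_roots_def intro: wt_mem_dual)

lemma aff_n_plus_subset_span_root_spaces:
  "aff_n_plus \<subseteq> aff.span (\<Union>\<alpha>\<in>aff_pos_roots. aff_root_space \<alpha>)" (is "_ \<subseteq> ?S")
proof -
  have mem: "loop_elt n x \<in> ?S" if "\<gamma> \<in> weights" "x \<in> root_space H \<gamma>" "level \<gamma> n \<ge> 0" for n x \<gamma>
  proof -
    have "loop_elt n x \<in> aff_root_space (wt \<gamma> n)"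
      using that weights_subset_dual level_nonneg_nonzero[OF that(3)]
      by (subst aff_root_space_wt) auto
    then show ?thesis
      using that by (intro aff.span_base) (auto simp: aff_pos_roots_def)
  qed
  have "loop_elt n x \<in> ?S" if "n > 0" for n x
  proof -
    have "subspace {x. loop_elt n x \<in> ?S}"
      by (rule subspace_loop_elt_vimage) simp
    moreover have "y \<in> {x. loop_elt n x \<in> ?S}" if "\<gamma> \<in> weights" "y \<in> root_space H \<gamma>" for \<gamma> y
      using mem[OF that, of n] \<open>n > 0\<close> by (simp add: level_def)
    ultimately show ?thesis using subspace_weights_UNIV by blast
  qed
  moreover have "loop_elt 0 x \<in> ?S" if "x \<in> n_plus" for x
  proof -
    have "loop_elt 0 y \<in> ?S" if "\<gamma> \<in> Pos" "y \<in> root_space H \<gamma>" for \<gamma> y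
      using mem[of \<gamma> y 0] that by (simp add: level_def weights_def roots_eq)
    then have "n_plus \<subseteq> {x. loop_elt 0 x \<in> ?S}"
      unfolding n_plus_def by (intro span_minimal subspace_loop_elt_vimage) auto
    then show ?thesis using that by blast
  qed
  ultimately show ?thesis
    unfolding aff_n_plus_def by (intro aff.span_minimal) (auto simp: loop_elt_def)
qed

subsection \<open>Supports of thick ideals\<close>

text \<open>The support in coordinates, where translation and level are integer arithmetic. For
  ideals inside \<open>aff_n_plus\<close> the pair of zero weight and degree 0 cannot occur, so only
  roots are recorded.\<close>

definition coord_supp :: "'a affine set \<Rightarrow> (('a \<Rightarrow> complex) \<times> int) set" where
  "coord_supp I = {(\<gamma>, n). \<gamma> \<in> weights \<and> (\<forall>x\<in>root_space H \<gamma>. loop_elt n x \<in> I)}"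

lemma level_coord_supp:
  assumes "I \<subseteq> aff_n_plus" "(\<gamma>, n) \<in> coord_supp I"
  shows "level \<gamma> n \<ge> 0"
proof -
  obtain x where "x \<in> root_space H \<gamma>" "x \<noteq> 0"
    using assms weight_vector_exists by (auto simp: coord_supp_def)
  then show ?thesis
    using assms loop_elt_weight_vector_mem_aff_n_plus by (auto simp: coord_supp_def)
qed

lemma supp_eq:
  assumes "I \<subseteq> aff_n_plus"
  shows "supp I = (\<lambda>(\<gamma>, n). wt \<gamma> n) ` coord_supp I"
proof -
  have *: "wt \<gamma> n \<in> aff_roots \<and> aff_root_space (wt \<gamma> n) \<subseteq> I"
    if "(\<gamma>, n) \<in> coord_supp I" for \<gamma> n
  proof -
    have nz: "\<gamma> \<noteq> (\<lambda>_. 0) \<or> n \<noteq> 0"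
      using level_nonneg_nonzero[OF level_coord_supp[OF assms that]] .
    have "\<gamma> \<in> weights" "loop_elt n ` root_space H \<gamma> \<subseteq> I"
      using that by (auto simp: coord_supp_def)
    moreover from this have "aff_root_space (wt \<gamma> n) = loop_elt n ` root_space H \<gamma>"
      using aff_root_space_wt nz weights_subset_dual by blast
    ultimately show ?thesis
      using nz unfolding aff_roots_eq by blast
  qed
  have "\<alpha> \<in> (\<lambda>(\<gamma>, n). wt \<gamma> n) ` coord_supp I" if \<alpha>: "\<alpha> \<in> supp I" for \<alpha>
  proof -
    obtain \<gamma> n where "\<alpha> = wt \<gamma> n" "\<gamma> \<in> weights" "\<gamma> \<noteq> (\<lambda>_. 0) \<or> n \<noteq> 0" "aff_root_space \<alpha> \<subseteq> I"
      using \<alpha> by (auto simp: supp_def aff_roots_eq)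
    moreover from this have "aff_root_space \<alpha> = loop_elt n ` root_space H \<gamma>"
      using weights_subset_dual aff_root_space_wt by blast
    ultimately show ?thesis by (force simp: coord_supp_def)
  qed
  then show ?thesis using * by (auto simp: supp_def)
qed

lemma wt_mem_supp_iff:
  assumes "I \<subseteq> aff_n_plus" "\<gamma> \<in> weights"
  shows "wt \<gamma> n \<in> supp I \<longleftrightarrow> (\<gamma>, n) \<in> coord_supp I"
proof
  assume "wt \<gamma> n \<in> supp I"
  then obtain \<gamma>' n' where *: "wt \<gamma> n = wt \<gamma>' n'" "(\<gamma>', n') \<in> coord_supp I"
    by (auto simp: supp_eq[OF assms(1)])
  then have "\<gamma> = \<gamma>' \<and> n = n'"
    using wt_eq_iff[of \<gamma> \<gamma>' n n'] assms(2) weights_subset_dual by (auto simp: coord_supp_def)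
  then show "(\<gamma>, n) \<in> coord_supp I" using * by simp
qed (force simp: supp_eq[OF assms(1)])

lemma coord_supp_eq_of_supp_shift:
  assumes "I \<subseteq> aff_n_plus" "J \<subseteq> aff_n_plus" "supp I = shift k ` supp J"
  shows "coord_supp I = (\<lambda>(\<gamma>, n). (\<gamma>, n + k)) ` coord_supp J"
proof -
  have *: "(\<gamma>, n) \<in> coord_supp I \<longleftrightarrow> (\<gamma>, n - k) \<in> coord_supp J" if "\<gamma> \<in> weights" for \<gamma> n
  proof -
    have "wt \<gamma> n \<in> supp I \<longleftrightarrow> wt \<gamma> (n - k) \<in> supp J"
    proof
      assume "wt \<gamma> n \<in> supp I"
      then obtain \<beta> where "wt \<gamma> n = shift k \<beta>" "\<beta> \<in> supp J" using assms(3) by blast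
      moreover from this have "wt \<gamma> (n - k) = \<beta>" using shift_wt[of "- k" \<gamma> n] by simp
      ultimately show "wt \<gamma> (n - k) \<in> supp J" by simp
    next
      assume "wt \<gamma> (n - k) \<in> supp J"
      then have "shift k (wt \<gamma> (n - k)) \<in> supp I" using assms(3) by blast
      then show "wt \<gamma> n \<in> supp I" by (simp add: shift_wt)
    qed
    then show ?thesis
      using wt_mem_supp_iff[OF assms(1) that] wt_mem_supp_iff[OF assms(2) that] by simp
  qed
  show ?thesis
  proof (intro equalityI subsetI)
    fix p assume "p \<in> coord_supp I"
    then show "p \<in> (\<lambda>(\<gamma>, n). (\<gamma>, n + k)) ` coord_supp J"
      using * by (cases p) (force simp: coord_supp_def image_iff)
  next
    fix p assume "p \<in> (\<lambda>(\<gamma>, n). (\<gamma>, n + k)) ` coord_supp J"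
    then obtain \<gamma> n where p: "p = (\<gamma>, n + k)" "(\<gamma>, n) \<in> coord_supp J" by auto
    then show "p \<in> coord_supp I"
      using *[of \<gamma> "n + k"] by (simp add: coord_supp_def)
  qed
qed

lemma supp_shift_of_coord_supp_eq:
  assumes "I \<subseteq> aff_n_plus" "J \<subseteq> aff_n_plus"
    and "coord_supp I = (\<lambda>(\<gamma>, n). (\<gamma>, n + k)) ` coord_supp J"
  shows "supp I = shift k ` supp J"
  by (simp add: supp_eq assms image_image case_prod_unfold shift_wt)

text \<open>The form in which thickness is applied: one nonzero vector obtained from a bracket
  brings in its whole root space.\<close>

lemma thick_coord_supp:
  assumes "thick_ideal I" "I \<subseteq> aff_n_plus"
    and "\<gamma> \<in> weights" "x \<in> root_space H \<gamma>" "x \<noteq> 0" "loop_elt n x \<in> I"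
  shows "(\<gamma>, n) \<in> coord_supp I"
proof -
  have nz: "\<gamma> \<noteq> (\<lambda>_. 0) \<or> n \<noteq> 0"
    using assms loop_elt_weight_vector_mem_aff_n_plus level_nonneg_nonzero by blast
  then have *: "aff_root_space (wt \<gamma> n) = loop_elt n ` root_space H \<gamma>"
    using aff_root_space_wt assms(3) weights_subset_dual by blast
  moreover have "wt \<gamma> n \<in> aff_roots" using nz assms(3) by (auto simp: aff_roots_eq)
  moreover have "I \<inter> aff_root_space (wt \<gamma> n) \<noteq> {0}"
    using assms(4-6) * loop_elt_eq_0_iff[of n x] by blast
  ultimately have "aff_root_space (wt \<gamma> n) \<subseteq> I"
    using assms(1) unfolding thick_ideal_def by blast
  then show ?thesis using * assms(3) by (auto simp: coord_supp_def)
qed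

lemma subspace_of_ideal: "aff.ideal_of aff_borel I \<Longrightarrow> aff.subspace I"
  by (simp add: aff.ideal_of_def)

text \<open>An ideal of \<open>aff_borel\<close> is stable under \<open>aff_H\<close>, so it
  contains the weight components of its elements; thickness extends each nonzero component to a full
  root space.\<close>

lemma thick_ideal_eq_span:
  assumes "thick_ideal I" "I \<subseteq> aff_n_plus"
  shows "I = aff.span (\<Union>(\<gamma>, n)\<in>coord_supp I. loop_elt n ` root_space H \<gamma>)" (is "_ = aff.span ?U")
proof
  have I: "aff.ideal_of aff_borel I" using assms by (simp add: thick_ideal_def)
  show "aff.span ?U \<subseteq> I"
    using subspace_of_ideal[OF I] by (intro aff.span_minimal) (auto simp: coord_supp_def)
  show "I \<subseteq> aff.span ?U"
  proof
    fix X assume X: "X \<in> I"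
    have "X \<in> aff.span (\<Union>\<alpha>\<in>aff_pos_roots. I \<inter> aff_root_space \<alpha>)"
    proof (rule aff.stable_subspace_weight_span)
      show "aff_br h Y \<in> I" if "h \<in> aff_H" "Y \<in> I" for h Y
        using I that aff_H_subset_aff_borel by (auto simp: aff.ideal_of_def)
      show "X \<in> aff.span (\<Union>\<alpha>\<in>aff_pos_roots. aff_root_space \<alpha>)"
        using X assms aff_n_plus_subset_span_root_spaces by blast
    qed (use X I in \<open>auto simp: subspace_of_ideal aff_pos_roots_subset_dual\<close>)
    also have "aff.span (\<Union>\<alpha>\<in>aff_pos_roots. I \<inter> aff_root_space \<alpha>) \<subseteq> aff.span ?U"
    proof (intro aff.span_minimal subsetI)
      fix Y assume "Y \<in> (\<Union>\<alpha>\<in>aff_pos_roots. I \<inter> aff_root_space \<alpha>)"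
      then obtain \<gamma> n where *: "\<gamma> \<in> weights" "level \<gamma> n \<ge> 0" "Y \<in> I" "Y \<in> aff_root_space (wt \<gamma> n)"
        by (auto simp: aff_pos_roots_def)
      then obtain x where x: "Y = loop_elt n x" "x \<in> root_space H \<gamma>"
        using aff_root_space_wt level_nonneg_nonzero weights_subset_dual by blast
      show "Y \<in> aff.span ?U"
      proof (cases "x = 0")
        case True
        then show ?thesis using x aff.span_zero by simp
      next
        case False
        then have "(\<gamma>, n) \<in> coord_supp I" using thick_coord_supp assms * x by blast
        then show ?thesis using x by (auto intro!: aff.span_base)
      qed
    qed simp
    finally show "X \<in> aff.span ?U" .
  qed
qed

text \<open>Bracket e \<otimes> t^n with f \<otimes> t^m, where f has weight -\<gamma>. Degree m = 0
  is available only when -\<gamma> is positive, as f \<otimes> 1 must lie in the Borel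
  subalgebra.\<close>

lemma coord_supp_imaginary:
  assumes I: "thick_ideal I" "I \<subseteq> aff_n_plus"
    and \<gamma>: "(\<gamma>, n) \<in> coord_supp I" "\<gamma> \<in> roots H" and m: "m > 0 \<or> m = 0 \<and> \<gamma> \<in> Neg" "n \<ge> 0"
  shows "((\<lambda>_. 0), n + m) \<in> coord_supp I"
proof -
  have "\<gamma> \<in> weights" using \<gamma> by (simp add: weights_def)
  then obtain e where e: "e \<in> root_space H \<gamma>" "e \<noteq> 0" by (rule weight_vector_exists)
  obtain f where f: "f \<in> root_space H (\<lambda>x. - \<gamma> x)" "br f e \<in> H" "br f e \<noteq> 0"
    using opposite_root_vectors_br[OF \<gamma>(2) e] .
  have "loop_elt m f \<in> aff_borel"
    using m f(1) \<gamma>(2) root_space_Pos_subset[of "\<lambda>x. - \<gamma> x"]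
    by (intro loop_elt_mem_aff_borel) (auto simp: uminus_mem_Pos_iff)
  moreover have "loop_elt n e \<in> I" using \<gamma> e by (auto simp: coord_supp_def)
  ultimately have "aff_br (loop_elt m f) (loop_elt n e) \<in> I"
    using I by (auto simp: thick_ideal_def aff.ideal_of_def)
  then have "loop_elt (n + m) (br f e) \<in> I"
    using m by (auto simp: aff_br_loop_elt add.commute)
  then show ?thesis
    using f by (intro thick_coord_supp[OF I, of _ "br f e"]) (auto simp: root_space_zero weights_def)
qed

text \<open>Bracket h \<otimes> t^n with e \<otimes> t^m for a root vector e. All of H \<otimes> t^n
  lies in \<open>I\<close>, so h can be chosen with \<gamma>(h) \<noteq> 0.\<close>

lemma coord_supp_real:
  assumes I: "thick_ideal I" "I \<subseteq> aff_n_plus"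
    and n: "((\<lambda>_. 0), n) \<in> coord_supp I" "n \<ge> 0"
    and \<gamma>: "\<gamma> \<in> roots H" and m: "m > 0 \<or> m = 0 \<and> \<gamma> \<in> Pos"
  shows "(\<gamma>, n + m) \<in> coord_supp I"
proof -
  have "\<gamma> \<in> weights" using \<gamma> by (simp add: weights_def)
  then obtain e where e: "e \<in> root_space H \<gamma>" "e \<noteq> 0" by (rule weight_vector_exists)
  obtain h where h: "h \<in> H" "\<gamma> h \<noteq> 0" using root_nonzero_on_H[OF \<gamma>] .
  have "loop_elt m e \<in> aff_borel"
    using m e root_space_Pos_subset by (intro loop_elt_mem_aff_borel) auto
  moreover have "loop_elt n h \<in> I" using n h by (auto simp: coord_supp_def root_space_zero)
  ultimately have "aff_br (loop_elt m e) (loop_elt n h) \<in> I"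
    using I by (auto simp: thick_ideal_def aff.ideal_of_def)
  moreover have "br e h = (- \<gamma> h) *s e" using e h by (simp add: root_space_def br_minus[of e h])
  ultimately have "loop_elt (n + m) ((- \<gamma> h) *s e) \<in> I"
    using m n by (auto simp: aff_br_loop_elt add.commute)
  then show ?thesis
    using e h \<open>\<gamma> \<in> weights\<close>
    by (intro thick_coord_supp[OF I, of _ "(- \<gamma> h) *s e"])
      (auto intro!: subspace_neg subspace_scale subspace_root_space)
qed

lemma coord_supp_of_level_zero:
  assumes I: "thick_ideal I" "I \<subseteq> aff_n_plus"
    and lv: "(\<gamma>, n) \<in> coord_supp I" "level \<gamma> n = 0"
    and lv': "\<gamma>' \<in> weights" "level \<gamma>' n' \<ge> 1"
  shows "(\<gamma>', n') \<in> coord_supp I"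
proof -
  have "\<gamma> \<in> weights" using lv by (simp add: coord_supp_def)
  then consider "\<gamma> = (\<lambda>_. 0)" | "\<gamma> \<in> Pos" | "\<gamma> \<in> Neg" "\<gamma> \<notin> Pos"
    using Pos_Neg_disjoint by (auto simp: weights_def roots_eq)
  \<comment> \<open>At level 0 the degree n is 0 for \<gamma> in \<open>Pos\<close> and 1 otherwise,
    so the opposite root vector is taken in degree 1 or 0 to reach total degree 1.\<close>
  then have delta: "((\<lambda>_. 0), 1) \<in> coord_supp I"
  proof cases
    case 1
    then show ?thesis using lv zero_not_root by (simp add: level_def)
  next
    case 2
    then show ?thesis
      using coord_supp_imaginary[OF I lv(1), of 1] lv by (simp add: level_def roots_eq)
  next
    case 3
    then show ?thesis
      using coord_supp_imaginary[OF I lv(1), of 0] lv by (simp add: level_def roots_eq)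
  qed
  have real: "(\<beta>, k) \<in> coord_supp I" if "\<beta> \<in> roots H" "level \<beta> k \<ge> 1" for \<beta> k
  proof -
    have "k - 1 > 0 \<or> k - 1 = 0 \<and> \<beta> \<in> Pos"
      using that(2) by (auto simp: level_def split: if_splits)
    then show ?thesis using coord_supp_real[OF I delta, of \<beta> "k - 1"] that(1) by simp
  qed
  show ?thesis
  proof (cases "\<gamma>' \<in> roots H")
    case True
    then show ?thesis using real lv' by blast
  next
    case False
    then have *: "\<gamma>' = (\<lambda>_. 0)" using lv' by (simp add: weights_def)
    \<comment> \<open>Elements of H \<otimes> t^k commute with \<delta>-vectors, so higher multiples
      of \<delta> are reached through the real root \<beta> + \<delta>, with an opposite root vector
      in degree \<open>n' - 1\<close> > 0.\<close>
    then have "n' \<ge> 2" using lv' zero_not_root by (simp add: level_def)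
    moreover obtain \<beta> where "\<beta> \<in> Pos" using Pos_nonempty by blast
    moreover from this have "(\<beta>, 1) \<in> coord_supp I"
      using real by (simp add: level_def roots_eq)
    ultimately show ?thesis
      using coord_supp_imaginary[OF I, of \<beta> 1 "n' - 1"] * by (auto simp: roots_eq)
  qed
qed

subsection \<open>Translation by multiples of the imaginary root\<close>

text \<open>Multiplication by t^k. \<open>map_key\<close> pulls coefficients back along its
  argument, hence the minus sign.\<close>

definition tmul :: "int \<Rightarrow> (int \<Rightarrow>\<^sub>0 'a) \<Rightarrow> (int \<Rightarrow>\<^sub>0 'a)" where
  "tmul k f = Poly_Mapping.map_key (\<lambda>n. n - k) f"

lemma lookup_tmul: "Poly_Mapping.lookup (tmul k f) n = Poly_Mapping.lookup f (n - k)"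
  by (simp add: tmul_def Poly_Mapping.map_key.rep_eq inj_on_def)

lemma tmul_single: "tmul k (Poly_Mapping.single n x) = Poly_Mapping.single (n + k) x"
  by (rule poly_mapping_eqI) (auto simp: lookup_tmul lookup_single when_def)

lemma tmul_add: "tmul k (f + g) = tmul k f + tmul k g"
  by (rule poly_mapping_eqI) (simp add: lookup_tmul lookup_add)

lemma tmul_scale: "tmul k (Poly_Mapping.map (scale c) f) = Poly_Mapping.map (scale c) (tmul k f)"
  by (rule poly_mapping_eqI) (simp add: lookup_tmul lookup_map_scale)

lemma tmul_zero [simp]: "tmul k 0 = 0"
  by (rule poly_mapping_eqI) (simp add: lookup_tmul)

lemma tmul_tmul: "tmul k (tmul l f) = tmul (k + l) f"
  by (rule poly_mapping_eqI) (simp add: lookup_tmul algebra_simps)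

lemma tmul_by_zero [simp]: "tmul 0 f = f"
  by (rule poly_mapping_eqI) (simp add: lookup_tmul)

lemma loop_br_tmul: "loop_br g (tmul k f) = tmul k (loop_br g f)"
  by (rule poly_mapping_eqI) (simp add: lookup_loop_br lookup_tmul algebra_simps)

text \<open>The Leibniz rule for t d/dt applied to t^k f.\<close>

lemma degree_der_tmul:
  "degree_der (tmul k f) = tmul k (degree_der f + Poly_Mapping.map (scale (of_int k)) f)"
  by (rule poly_mapping_eqI)
    (simp add: lookup_degree_der lookup_tmul lookup_add lookup_map_scale flip: scale_left_distrib)

text \<open>Only the loop part can be multiplied by t^k; ideals inside \<open>aff_n_plus\<close>
  have no c- or d-component to lose.\<close>

definition shift_ideal :: "int \<Rightarrow> 'a affine set \<Rightarrow> 'a affine set" where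
  "shift_ideal k I = {(tmul k f, 0, 0) |f. (f, 0, 0) \<in> I}"

lemma loop_elt_mem_shift_ideal: "loop_elt n x \<in> shift_ideal k I \<longleftrightarrow> loop_elt (n - k) x \<in> I"
proof
  assume "loop_elt n x \<in> shift_ideal k I"
  then obtain f where f: "Poly_Mapping.single n x = tmul k f" "(f, 0, 0) \<in> I"
    by (auto simp: shift_ideal_def loop_elt_def)
  have "f = tmul (- k) (Poly_Mapping.single n x)" by (simp add: f(1) tmul_tmul)
  then show "loop_elt (n - k) x \<in> I" using f(2) by (simp add: tmul_single loop_elt_def)
next
  assume "loop_elt (n - k) x \<in> I"
  moreover have "Poly_Mapping.single n x = tmul k (Poly_Mapping.single (n - k) x)"
    by (simp add: tmul_single)
  ultimately show "loop_elt n x \<in> shift_ideal k I"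
    by (auto simp: shift_ideal_def loop_elt_def)
qed

lemma mem_coord_supp_shift_ideal:
  "(\<gamma>, n) \<in> coord_supp (shift_ideal k I) \<longleftrightarrow> (\<gamma>, n - k) \<in> coord_supp I"
  by (simp add: coord_supp_def loop_elt_mem_shift_ideal)

lemma coord_supp_shift_ideal:
  "coord_supp (shift_ideal k I) = (\<lambda>(\<gamma>, n). (\<gamma>, n + k)) ` coord_supp I"
proof (intro equalityI subsetI)
  fix p assume "p \<in> coord_supp (shift_ideal k I)"
  then show "p \<in> (\<lambda>(\<gamma>, n). (\<gamma>, n + k)) ` coord_supp I"
    by (cases p) (force simp: mem_coord_supp_shift_ideal image_iff)
qed (auto simp: mem_coord_supp_shift_ideal)

lemma shift_ideal_subset_aff_n_plus:
  assumes "thick_ideal I" "I \<subseteq> aff_n_plus"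
    and "\<And>\<gamma> n. (\<gamma>, n) \<in> coord_supp I \<Longrightarrow> level \<gamma> n + k \<ge> 0"
  shows "shift_ideal k I \<subseteq> aff_n_plus"
proof -
  \<comment> \<open>\<open>?V\<close> collects the elements whose loop part is carried into
    \<open>aff_n_plus\<close>. As it is a subspace, \<open>thick_ideal_eq_span\<close> reduces the
    claim to root vectors, where the level bound decides.\<close>
  let ?V = "{X :: 'a affine. (tmul k (fst X), 0, 0) \<in> aff_n_plus}"
  have N: "aff.subspace aff_n_plus" by (simp add: aff_n_plus_def)
  have "aff.subspace ?V"
    unfolding aff.subspace_def
  proof (intro conjI allI ballI)
    show "0 \<in> ?V" using aff.subspace_0[OF N] by (simp add: zero_prod_def)
    fix X Y assume XY: "X \<in> ?V" "Y \<in> ?V"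
    show "X + Y \<in> ?V"
      using aff.subspace_add[OF N, of "(tmul k (fst X), 0, 0)" "(tmul k (fst Y), 0, 0)"] XY
      by (simp add: tmul_add)
  next
    fix c X assume X: "X \<in> ?V"
    show "aff_scale c X \<in> ?V"
      using aff.subspace_scale[OF N, of "(tmul k (fst X), 0, 0)" c] X
      by (simp add: aff_scale_def tmul_scale case_prod_unfold)
  qed
  moreover have "loop_elt n x \<in> ?V" if "(\<gamma>, n) \<in> coord_supp I" "x \<in> root_space H \<gamma>" for \<gamma> n x
  proof -
    have "loop_elt (n + k) x \<in> aff_n_plus"
    proof (cases "x = 0")
      case True
      then show ?thesis using aff.subspace_0[OF N] by simp
    next
      case False
      then show ?thesis
        using that assms(3)[OF that(1)] loop_elt_weight_vector_mem_aff_n_plus[of \<gamma> x "n + k"]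
        by (simp add: level_shift coord_supp_def)
    qed
    then show ?thesis by (simp add: loop_elt_def tmul_single)
  qed
  ultimately have "aff.span (\<Union>(\<gamma>, n)\<in>coord_supp I. loop_elt n ` root_space H \<gamma>) \<subseteq> ?V"
    by (intro aff.span_minimal) auto
  then have "I \<subseteq> ?V" using thick_ideal_eq_span[OF assms(1,2)] by simp
  then show ?thesis by (auto simp: shift_ideal_def)
qed

lemma aff_n_plus_subset_aff_borel: "aff_n_plus \<subseteq> aff_borel"
  using subspace_0[OF subspace_H] by (force simp: aff_n_plus_eq aff_borel_eq)

text \<open>For k < 0 the first factor vanishes, for k > 0 the second one does, being in degree -k,
  and the term at k = 0 has coefficient 0.\<close>

lemma cocycle_borel_n_plus:
  assumes "(g, a, b) \<in> aff_borel" "(f, 0, 0) \<in> aff_n_plus"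
  shows "cocycle g f = 0"
  unfolding cocycle_def
proof (intro sum.neutral ballI)
  fix k
  show "of_int k * form (Poly_Mapping.lookup g k) (Poly_Mapping.lookup f (- k)) = 0"
    using assms by (cases "k < 0"; cases "k = 0") (auto simp: aff_borel_eq aff_n_plus_eq)
qed

lemma aff_br_borel_n_plus:
  assumes "(g, a, b) \<in> aff_borel" "(f, 0, 0) \<in> aff_n_plus"
  shows "aff_br (g, a, b) (f, 0, 0) =
    (loop_br g f + Poly_Mapping.map (scale b) (degree_der f), 0, 0)"
proof -
  have "Poly_Mapping.map (scale 0) (degree_der g) = 0"
    by (rule poly_mapping_eqI) (simp add: lookup_map_scale)
  then show ?thesis using cocycle_borel_n_plus[OF assms] by (simp add: aff_br_def)
qed

text \<open>Multiplication by \<open>t^k\<close> commutes with the loop bracket, and changes the action of \<open>d\<close> by a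
  scalar only; the central term never appears inside \<open>aff_borel\<close>.\<close>

lemma ideal_of_shift_ideal:
  assumes I: "aff.ideal_of aff_borel I" "I \<subseteq> aff_n_plus" and J: "shift_ideal k I \<subseteq> aff_n_plus"
  shows "aff.ideal_of aff_borel (shift_ideal k I)"
  unfolding aff.ideal_of_def
proof (intro conjI ballI)
  have sub: "aff.subspace I" by (rule subspace_of_ideal[OF I(1)])
  have add: "(f + g, 0, 0) \<in> I" if "(f, 0, 0) \<in> I" "(g, 0, 0) \<in> I" for f g
    using aff.subspace_add[OF sub that] by simp
  have scale: "(Poly_Mapping.map (scale c) f, 0, 0) \<in> I" if "(f, 0, 0) \<in> I" for c f
    using aff.subspace_scale[OF sub that, of c] by (simp add: aff_scale_def)
  show "aff.subspace (shift_ideal k I)"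
    unfolding aff.subspace_def
  proof (intro conjI allI ballI)
    have "(0, 0, 0) \<in> I" using aff.subspace_0[OF sub] by (simp add: zero_prod_def)
    then show "0 \<in> shift_ideal k I"
      by (auto simp: shift_ideal_def zero_prod_def intro!: exI[of _ 0])
    fix X Y assume "X \<in> shift_ideal k I" "Y \<in> shift_ideal k I"
    then obtain f g where "X = (tmul k f, 0, 0)" "Y = (tmul k g, 0, 0)"
      "(f, 0, 0) \<in> I" "(g, 0, 0) \<in> I" by (auto simp: shift_ideal_def)
    then show "X + Y \<in> shift_ideal k I"
      using add by (auto simp: shift_ideal_def tmul_add intro!: exI[of _ "f + g"])
  next
    fix c X assume "X \<in> shift_ideal k I"
    then obtain f where "X = (tmul k f, 0, 0)" "(f, 0, 0) \<in> I" by (auto simp: shift_ideal_def)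
    then show "aff_scale c X \<in> shift_ideal k I"
      using scale[of f c]
      by (auto simp: shift_ideal_def aff_scale_def
          intro!: exI[of _ "Poly_Mapping.map (scale c) f"] tmul_scale[symmetric])
  qed
  show "shift_ideal k I \<subseteq> aff_borel" using J aff_n_plus_subset_aff_borel by blast
  fix X Y assume X: "X \<in> aff_borel" and Y: "Y \<in> shift_ideal k I"
  obtain g a b where X_eq: "X = (g, a, b)" by (cases X)
  obtain f where f: "Y = (tmul k f, 0, 0)" "(f, 0, 0) \<in> I" using Y by (auto simp: shift_ideal_def)
  \<comment> \<open>The last summand is the extra term of the Leibniz rule
    \<open>degree_der_tmul\<close>, scaled by the d-component \<open>b\<close>; it stays in
    \<open>I\<close> because it is a multiple of \<open>f\<close>.\<close>
  let ?h = "loop_br g f + Poly_Mapping.map (scale b) (degree_der f)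
    + Poly_Mapping.map (scale (b * of_int k)) f"
  have "aff_br X (f, 0, 0) \<in> I" using I X f by (auto simp: aff.ideal_of_def)
  then have "(loop_br g f + Poly_Mapping.map (scale b) (degree_der f), 0, 0) \<in> I"
    using X f I by (subst (asm) X_eq, subst (asm) aff_br_borel_n_plus) (auto simp: X_eq)
  then have "(?h, 0, 0) \<in> I" using add scale f by blast
  moreover have "aff_br X Y = (tmul k ?h, 0, 0)"
  proof -
    have "aff_br X Y =
        (loop_br g (tmul k f) + Poly_Mapping.map (scale b) (degree_der (tmul k f)), 0, 0)"
      using X Y J by (auto simp: X_eq f(1) intro!: aff_br_borel_n_plus)
    also have "loop_br g (tmul k f) + Poly_Mapping.map (scale b) (degree_der (tmul k f)) = tmul k ?h"
      by (simp add: loop_br_tmul degree_der_tmul tmul_add tmul_scale map_scale_add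
          map_scale_map_scale add.assoc)
    finally show ?thesis .
  qed
  ultimately show "aff_br X Y \<in> shift_ideal k I" by (auto simp: shift_ideal_def)
qed

lemma thick_ideal_shift_ideal:
  assumes I: "thick_ideal I" "I \<subseteq> aff_n_plus" and J: "shift_ideal k I \<subseteq> aff_n_plus"
  shows "thick_ideal (shift_ideal k I)"
proof -
  have ideal: "aff.ideal_of aff_borel (shift_ideal k I)"
    using assms by (intro ideal_of_shift_ideal) (auto simp: thick_ideal_def)
  have "aff_root_space \<alpha> \<subseteq> shift_ideal k I"
    if \<alpha>: "\<alpha> \<in> aff_roots" "shift_ideal k I \<inter> aff_root_space \<alpha> \<noteq> {0}" for \<alpha>
  proof -
    obtain \<gamma> n where *: "\<alpha> = wt \<gamma> n" "\<gamma> \<in> weights" "\<gamma> \<noteq> (\<lambda>_. 0) \<or> n \<noteq> 0"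
      using \<alpha>(1) by (auto simp: aff_roots_eq)
    then have sp: "aff_root_space \<alpha> = loop_elt n ` root_space H \<gamma>"
      using aff_root_space_wt weights_subset_dual by blast
    have "0 \<in> shift_ideal k I \<inter> aff_root_space \<alpha>"
      using aff.subspace_0 subspace_of_ideal[OF ideal] aff.subspace_root_space by blast
    then obtain x where x: "x \<in> root_space H \<gamma>" "loop_elt n x \<in> shift_ideal k I" "loop_elt n x \<noteq> 0"
      using \<alpha>(2) unfolding sp by blast
    then have "(\<gamma>, n - k) \<in> coord_supp I"
      using thick_coord_supp[OF I *(2) x(1)] by (simp add: loop_elt_mem_shift_ideal)
    then show ?thesis unfolding sp by (auto simp: coord_supp_def loop_elt_mem_shift_ideal)
  qed
  then show ?thesis using ideal by (simp add: thick_ideal_def)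
qed

text \<open>From degree 2 on every weight has level at least 1, so all x \<otimes> t^k with k \<ge>
  2 lie in \<open>I\<close>. What remains is spanned by finitely many elements of degrees 0 and 1
  together with c and d.\<close>

lemma finite_codim_of_level_zero:
  assumes I: "thick_ideal I" "I \<subseteq> aff_n_plus"
    and lv: "(\<gamma>, n) \<in> coord_supp I" "level \<gamma> n = 0"
  shows "aff.finite_codim aff_borel I"
proof -
  let ?W = "{h + x |h x. h \<in> H \<and> x \<in> n_plus}"
  obtain E where E: "finite E" "E \<subseteq> ?W" "?W \<subseteq> span E"
    using finite_dim_subspace_finite_span[OF fin_dim] .
  obtain G where G: "finite G" "span G = UNIV"
    using fin_dim by (auto simp: finite_dim_def)
  let ?F = "loop_elt 0 ` E \<union> loop_elt 1 ` G \<union> {(0, 1, 0), (0, 0, 1)}"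
  let ?S = "aff.span (I \<union> ?F)"
  have W0: "0 \<in> ?W"
    using subspace_0 subspace_H subspace_n_plus by force
  have "?F \<subseteq> aff_borel"
  proof -
    have "loop_elt 0 e \<in> aff_borel" if "e \<in> ?W" for e
      using that by (simp add: aff_borel_eq loop_elt_def lookup_single)
    moreover have "(0, a, b) \<in> aff_borel" for a b
      using W0 by (simp add: aff_borel_eq)
    moreover have "loop_elt 1 x \<in> aff_borel" for x
      by (rule loop_elt_mem_aff_borel) simp
    ultimately show ?thesis
      using subsetD[OF E(2)] by (simp add: image_subset_iff)
  qed
  moreover have "X \<in> ?S" if X: "X \<in> aff_borel" for X
  proof -
    obtain f a b where f: "X = (f, a, b)" "\<forall>k<0. Poly_Mapping.lookup f k = 0"
      "Poly_Mapping.lookup f 0 \<in> ?W" using X unfolding aff_borel_eq by blast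
    have sub: "subspace {x. loop_elt k x \<in> ?S}" for k
      by (rule subspace_loop_elt_vimage) simp
    have "span E \<subseteq> {x. loop_elt 0 x \<in> ?S}"
      by (intro span_minimal sub) (auto intro: aff.span_base)
    then have "?W \<subseteq> {x. loop_elt 0 x \<in> ?S}" using E(3) by (rule order_trans[rotated])
    then have 0: "loop_elt 0 (Poly_Mapping.lookup f 0) \<in> ?S" using f(3) by blast
    have "span G \<subseteq> {x. loop_elt 1 x \<in> ?S}"
      by (intro span_minimal sub) (auto intro: aff.span_base)
    then have 1: "loop_elt 1 x \<in> ?S" for x using G(2) by blast
    have 2: "loop_elt k x \<in> ?S" if k: "k \<ge> 2" for k x
    proof -
      have "aff.subspace I" using I by (auto simp: thick_ideal_def intro: subspace_of_ideal)
      moreover have "loop_elt k y \<in> I" if "\<beta> \<in> weights" "y \<in> root_space H \<beta>" for \<beta> y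
      proof -
        have "level \<beta> k \<ge> 1" using k by (simp add: level_def)
        then show ?thesis
          using coord_supp_of_level_zero[OF I lv that(1)] that(2) by (auto simp: coord_supp_def)
      qed
      ultimately have "loop_elt k x \<in> I"
        using subspace_weights_UNIV[of "{x. loop_elt k x \<in> I}" x] subspace_loop_elt_vimage by blast
      then show ?thesis by (auto intro: aff.span_base)
    qed
    have "(\<Sum>k\<in>Poly_Mapping.keys f. loop_elt k (Poly_Mapping.lookup f k)) \<in> ?S"
    proof (rule aff.span_sum)
      fix k assume "k \<in> Poly_Mapping.keys f"
      then have "\<not> k < 0" using f(2) by (auto simp: in_keys_iff)
      then consider "k = 0" | "k = 1" | "k \<ge> 2" by linarith
      then show "loop_elt k (Poly_Mapping.lookup f k) \<in> ?S"
        using 0 1 2 by cases auto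
    qed
    moreover have "aff_scale a (0, 1, 0) + aff_scale b (0, 0, 1) \<in> ?S"
      by (intro aff.span_add aff.span_scale aff.span_base) auto
    moreover have "X = (f, 0, 0) + (aff_scale a (0, 1, 0) + aff_scale b (0, 0, 1))"
      by (simp add: f(1) aff_scale_def)
    ultimately show ?thesis using aff.span_add by (simp add: sum_loop_elt)
  qed
  ultimately show ?thesis
    unfolding aff.finite_codim_def using E(1) G(1) by (intro exI[of _ ?F]) auto
qed

lemma combinatorial_idealD:
  assumes "I \<in> combinatorial_ideals"
  shows "thick_ideal I" "I \<subseteq> aff_n_plus"
  using assms by (auto simp: combinatorial_ideals_def strong_ideal_def)

subsection \<open>Basic ideals\<close>

lemma basic_ideal_iff:
  "basic_ideal I \<longleftrightarrow> I \<in> combinatorial_ideals \<and> (\<exists>\<gamma> n. (\<gamma>, n) \<in> coord_supp I \<and> level \<gamma> n = 0)"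
proof -
  have "supp I \<inter> D 0 \<noteq> {} \<longleftrightarrow> (\<exists>\<gamma> n. (\<gamma>, n) \<in> coord_supp I \<and> level \<gamma> n = 0)"
    if "I \<in> combinatorial_ideals"
  proof -
    note N = combinatorial_idealD(2)[OF that]
    have "supp I \<inter> D 0 \<noteq> {} \<longleftrightarrow> (\<exists>\<gamma> n. wt \<gamma> n \<in> supp I \<and> \<gamma> \<in> weights \<and> level \<gamma> n = 0)"
      unfolding D_eq by auto
    also have "\<dots> \<longleftrightarrow> (\<exists>\<gamma> n. (\<gamma>, n) \<in> coord_supp I \<and> level \<gamma> n = 0)"
    proof -
      have "\<gamma> \<in> weights" if "(\<gamma>, n) \<in> coord_supp I" for \<gamma> n
        using that by (simp add: coord_supp_def)
      then show ?thesis using wt_mem_supp_iff[OF N] by meson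
    qed
    finally show ?thesis .
  qed
  then show ?thesis by (auto simp: basic_ideal_def)
qed

lemma basic_ideal_supp:
  assumes "basic_ideal I"
  shows "(\<Union>k\<in>{0<..}. D k) \<subseteq> supp I"
proof
  fix \<alpha> assume "\<alpha> \<in> (\<Union>k\<in>{0<..}. D k)"
  then obtain \<gamma> n where *: "\<alpha> = wt \<gamma> n" "\<gamma> \<in> weights" "level \<gamma> n \<ge> 1"
    by (force simp: D_eq)
  moreover have "I \<in> combinatorial_ideals" using assms by (simp add: basic_ideal_def)
  moreover have "(\<gamma>, n) \<in> coord_supp I"
    using assms * coord_supp_of_level_zero combinatorial_idealD unfolding basic_ideal_iff by blast
  ultimately show "\<alpha> \<in> supp I"
    using wt_mem_supp_iff combinatorial_idealD by blast
qed

text \<open>This is where finite codimension is exploited: an empty support would force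
  \<open>I\<close> = {0}, and the Borel subalgebra, which has elements of arbitrarily high degree,
  would have a finite spanning set.\<close>

lemma coord_supp_nonempty:
  assumes "I \<in> combinatorial_ideals"
  shows "coord_supp I \<noteq> {}"
proof
  assume "coord_supp I = {}"
  then have "I = {0}"
    using thick_ideal_eq_span[OF combinatorial_idealD[OF assms]] by simp
  moreover obtain F where F: "finite F" "aff_borel \<subseteq> aff.span (I \<union> F)"
    using assms by (auto simp: combinatorial_ideals_def strong_ideal_def aff.finite_codim_def)
  ultimately have B: "aff_borel \<subseteq> aff.span F" by simp
  have fin: "finite (\<Union>X\<in>F. Poly_Mapping.keys (fst X))" using F by simp
  \<comment> \<open>\<open>N\<close> exceeds every degree occurring in \<open>F\<close>. Inserting 0
    keeps the maximum defined and makes \<open>N\<close> positive, so that x \<otimes> t^N lies in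
    the Borel subalgebra.\<close>
  define N where "N = Max (insert 0 (\<Union>X\<in>F. Poly_Mapping.keys (fst X))) + 1"
  have N: "k < N" if "k \<in> insert 0 (\<Union>X\<in>F. Poly_Mapping.keys (fst X))" for k
    using Max_ge[OF _ that] fin by (simp add: N_def)
  let ?V = "{X :: 'a affine. Poly_Mapping.lookup (fst X) N = 0}"
  have "aff.subspace ?V"
    by (auto simp: aff.subspace_def aff_scale_def lookup_add lookup_map_scale case_prod_unfold)
  moreover have "F \<subseteq> ?V"
  proof
    fix X assume "X \<in> F"
    then have "Poly_Mapping.keys (fst X) \<subseteq> {..<N}" using N by auto
    then show "X \<in> ?V" by (auto simp: in_keys_iff)
  qed
  ultimately have V: "aff_borel \<subseteq> ?V"
    using B aff.span_minimal by blast
  have "(\<lambda>_. 0) \<in> weights" by (simp add: weights_def)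
  then obtain x where x: "x \<in> root_space H (\<lambda>_. 0)" "x \<noteq> 0" by (rule weight_vector_exists)
  have "loop_elt N x \<in> aff_borel" using N[of 0] by (intro loop_elt_mem_aff_borel) simp
  then show False using V x(2) by (auto simp: loop_elt_def)
qed

lemma equivalent_basic_ideal_exists:
  assumes "I \<in> combinatorial_ideals"
  obtains J where "basic_ideal J" "(I, J) \<in> equivalent_ideals"
proof -
  note I = combinatorial_idealD[OF assms]
  \<comment> \<open>Levels in the support are nonnegative, so a natural number can record them and
    the minimum is attained.\<close>
  let ?P = "\<lambda>m. \<exists>\<gamma> n. (\<gamma>, n) \<in> coord_supp I \<and> level \<gamma> n = int m"
  define m where "m = (LEAST m. ?P m)"
  obtain \<gamma>\<^sub>0 n\<^sub>0 where "(\<gamma>\<^sub>0, n\<^sub>0) \<in> coord_supp I"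
    using coord_supp_nonempty[OF assms] by auto
  then have "?P (nat (level \<gamma>\<^sub>0 n\<^sub>0))" using level_coord_supp[OF I(2)] by auto
  then have "?P m" unfolding m_def by (rule LeastI)
  then obtain \<gamma> n where m: "(\<gamma>, n) \<in> coord_supp I" "level \<gamma> n = int m" by blast
  have least: "level \<beta> k \<ge> int m" if "(\<beta>, k) \<in> coord_supp I" for \<beta> k
  proof -
    have "?P (nat (level \<beta> k))" using that level_coord_supp[OF I(2)] by auto
    then have "m \<le> nat (level \<beta> k)" unfolding m_def by (rule Least_le)
    then show ?thesis using level_coord_supp[OF I(2) that] by simp
  qed
  define J where "J = shift_ideal (- int m) I"
  have J_sub: "J \<subseteq> aff_n_plus"
    unfolding J_def using least by (intro shift_ideal_subset_aff_n_plus[OF I]) simp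
  have J_thick: "thick_ideal J"
    unfolding J_def using J_sub by (intro thick_ideal_shift_ideal[OF I]) (simp add: J_def)
  have mJ: "(\<gamma>, n - int m) \<in> coord_supp J" "level \<gamma> (n - int m) = 0"
    using m level_shift[of \<gamma> n "- int m"] by (simp_all add: J_def mem_coord_supp_shift_ideal)
  \<comment> \<open>Finite codimension comes from the level 0 element of \<open>J\<close> found
    above, not from that of \<open>I\<close>.\<close>
  have "strong_ideal J"
    using J_thick J_sub finite_codim_of_level_zero[OF J_thick J_sub mJ]
    by (simp add: strong_ideal_def thick_ideal_def)
  then have J: "J \<in> combinatorial_ideals" using J_thick by (simp add: combinatorial_ideals_def)
  have "supp J = shift (- int m) ` supp I"
    using supp_shift_of_coord_supp_eq[OF J_sub I(2)] by (simp add: J_def coord_supp_shift_ideal)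
  then have "(J, I) \<in> equivalent_ideals"
    using J assms by (auto simp: equivalent_ideals_def)
  then have "(I, J) \<in> equivalent_ideals"
    using equiv_equivalent_ideals by (meson equivE symD)
  moreover have "basic_ideal J" using J mJ by (auto simp: basic_ideal_iff)
  ultimately show thesis using that by blast
qed

text \<open>Translation by k sends a level 0 element of \<open>J\<close> to level k in
  \<open>I\<close>, where levels are nonnegative, so k \<ge> 0. A level 0 element of
  \<open>I\<close> comes from level -k in \<open>J\<close>, so k \<le> 0.\<close>

lemma equivalent_basic_ideals_eq:
  assumes "basic_ideal I" "basic_ideal J" "(I, J) \<in> equivalent_ideals"
  shows "I = J"
proof -
  have "I \<in> combinatorial_ideals" "J \<in> combinatorial_ideals"
    using assms by (auto simp: basic_ideal_def)
  note I = combinatorial_idealD[OF this(1)] and J = combinatorial_idealD[OF this(2)]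
  obtain k where "supp I = shift k ` supp J"
    using assms(3) by (auto simp: equivalent_ideals_def)
  then have eq: "coord_supp I = (\<lambda>(\<gamma>, n). (\<gamma>, n + k)) ` coord_supp J"
    by (rule coord_supp_eq_of_supp_shift[OF I(2) J(2)])
  obtain \<gamma> n where "(\<gamma>, n) \<in> coord_supp J" "level \<gamma> n = 0"
    using assms(2) by (auto simp: basic_ideal_iff)
  moreover from this have "(\<gamma>, n + k) \<in> coord_supp I" unfolding eq by force
  ultimately have "k \<ge> 0" using level_coord_supp[OF I(2)] level_shift by fastforce
  obtain \<beta> l where "(\<beta>, l) \<in> coord_supp I" "level \<beta> l = 0"
    using assms(1) by (auto simp: basic_ideal_iff)
  moreover from this obtain l' where "l = l' + k" "(\<beta>, l') \<in> coord_supp J"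
    unfolding eq by auto
  ultimately have "k \<le> 0" using level_coord_supp[OF J(2)] level_shift by fastforce
  with \<open>k \<ge> 0\<close> have "coord_supp I = coord_supp J" using eq by simp
  then show ?thesis using thick_ideal_eq_span[OF I] thick_ideal_eq_span[OF J] by simp
qed

section \<open>Finiteness and equivalence classes\<close>

lemma finite_basic_ideals: "finite {I. basic_ideal I}"
proof -
  let ?P = "\<lambda>m. {(\<gamma>, n). \<gamma> \<in> weights \<and> level \<gamma> n = m}"
  let ?Q = "{(\<gamma>, n). \<gamma> \<in> weights \<and> level \<gamma> n \<ge> 1}"
  \<comment> \<open>Level 0 forces degree 0 for weights in \<open>Pos\<close> and degree 1 for all
    others.\<close>
  have "?P 0 \<subseteq> weights \<times> {0, 1}" by (auto simp: level_def split: if_splits)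
  moreover have "finite weights" using finite_roots[OF fin_dim] by (simp add: weights_def)
  ultimately have "finite (?P 0)" using finite_subset by blast
  have inj: "inj_on coord_supp {I. basic_ideal I}"
  proof (rule inj_onI)
    fix I J assume "I \<in> {I. basic_ideal I}" "J \<in> {I. basic_ideal I}" "coord_supp I = coord_supp J"
    then show "I = J"
      using thick_ideal_eq_span[of I] thick_ideal_eq_span[of J]
      by (simp add: basic_ideal_def combinatorial_idealD)
  qed
  \<comment> \<open>All pairs of level at least 1 are present in the support of a basic ideal, so
    the only freedom is a subset of the finite set at level 0.\<close>
  have "coord_supp ` {I. basic_ideal I} \<subseteq> (\<lambda>S. S \<union> ?Q) ` Pow (?P 0)"
  proof
    fix S assume "S \<in> coord_supp ` {I. basic_ideal I}"
    then obtain I where I: "S = coord_supp I" "basic_ideal I" by blast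
    then have I': "thick_ideal I" "I \<subseteq> aff_n_plus" by (auto simp: basic_ideal_def combinatorial_idealD)
    have "?Q \<subseteq> S"
      using I coord_supp_of_level_zero[OF I'] by (auto simp: basic_ideal_iff)
    moreover have "S \<subseteq> ?P 0 \<union> ?Q"
      using level_coord_supp[OF I'(2)] unfolding I(1) by (fastforce simp: coord_supp_def)
    ultimately have "S = (S \<inter> ?P 0) \<union> ?Q" by blast
    then show "S \<in> (\<lambda>S. S \<union> ?Q) ` Pow (?P 0)" by blast
  qed
  then have "finite (coord_supp ` {I. basic_ideal I})"
    by (rule finite_subset) (simp add: \<open>finite (?P 0)\<close>)
  then show ?thesis using inj finite_imageD by blast
qed

lemma unique_basic_ideal_in_class:
  assumes "C \<in> combinatorial_ideals // equivalent_ideals"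
  shows "\<exists>!I. I \<in> C \<and> basic_ideal I"
proof -
  obtain I where I: "I \<in> combinatorial_ideals" "C = equivalent_ideals `` {I}"
    using assms by (auto elim: quotientE)
  obtain J where "basic_ideal J" "(I, J) \<in> equivalent_ideals"
    using equivalent_basic_ideal_exists[OF I(1)] .
  moreover have "K = K'" if "K \<in> C" "basic_ideal K" "K' \<in> C" "basic_ideal K'" for K K'
  proof -
    have "(K, K') \<in> equivalent_ideals"
      using that I quotient_eq_iff[OF equiv_equivalent_ideals assms assms] by blast
    then show ?thesis using equivalent_basic_ideals_eq that by blast
  qed
  ultimately show ?thesis using I(2) by blast
qed

lemma finite_classes: "finite (combinatorial_ideals // equivalent_ideals)"
proof -
  have "combinatorial_ideals // equivalent_ideals \<subseteq>
      (\<lambda>I. equivalent_ideals `` {I}) ` {I. basic_ideal I}"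
  proof
    fix C assume C: "C \<in> combinatorial_ideals // equivalent_ideals"
    then obtain I where I: "I \<in> C" "basic_ideal I" using unique_basic_ideal_in_class by blast
    have "C = equivalent_ideals `` {I}"
    proof -
      obtain J where J: "C = equivalent_ideals `` {J}" using C by (rule quotientE)
      then have "(J, I) \<in> equivalent_ideals" using I(1) by simp
      then show ?thesis using J equiv_class_eq[OF equiv_equivalent_ideals] by simp
    qed
    then show "C \<in> (\<lambda>I. equivalent_ideals `` {I}) ` {I. basic_ideal I}"
      by (rule image_eqI) (simp add: I(2))
  qed
  then show ?thesis by (rule finite_surj[OF finite_basic_ideals])
qed

end

theorem theorem2:
  fixes scale :: "complex \<Rightarrow> 'a::ab_group_add \<Rightarrow> 'a"
    and br :: "'a \<Rightarrow> 'a \<Rightarrow> 'a"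
    and H :: "'a set"
    and Pos :: "('a \<Rightarrow> complex) set"
    and form :: "'a \<Rightarrow> 'a \<Rightarrow> complex"
  assumes "affine_datum scale br H Pos form"
  shows "(\<forall>I. affine_datum.basic_ideal scale br H Pos form I \<longrightarrow>
            (\<Union>k\<in>{0<..}. affine_datum.D H Pos k) \<subseteq> affine_datum.supp scale br H form I) \<and>
         (\<forall>C \<in> affine_datum.combinatorial_ideals scale br H Pos form //
                affine_datum.equivalent_ideals scale br H Pos form.
            \<exists>!I. I \<in> C \<and> affine_datum.basic_ideal scale br H Pos form I) \<and>
         finite (affine_datum.combinatorial_ideals scale br H Pos form //
                 affine_datum.equivalent_ideals scale br H Pos form)"
proof -
  interpret affine_datum scale br H Pos form by fact
  show ?thesis
    using basic_ideal_supp unique_basic_ideal_in_class finite_classes by blast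
qed

end
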